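(* Let $V$ be a complex Hilbert space and let $g \in \mathrm{Sp}(V)$. There is a linear map $U_g : SV \to SV'$ determined by $U_g 1 = e^{Z_g}$ and the rule that if $v_1,\dots,v_n \in V$ then $$U_g(v_1 \cdots v_n) = c_g(v_1)\cdots c_g(v_n)\, e^{Z_g},$$ and the generalized Fock implementers for $g$ are precisely the nonzero scalar multiples of $U_g$.
   Context: $V$ is a complex Hilbert space with inner product $\langle\cdot|\cdot\rangle$ (antilinear in the first slot, linear in the second) and complex structure $J = i\,\cdot$. $\mathbb N=\{0,1,2,\dots\}$. $SV=\bigoplus_{d\in\mathbb N}S^dV$ is the (algebraic) symmetric algebra. $SV'$ is the space of all antilinear functionals $SV\to\mathbb C$ (no boundedness required). Product in $SV'$: let $\Delta:SV\to SV\otimes SV$ be the algebra homomorphism with $\Delta(v)=v\otimes 1+1\otimes v$ for $v\in V$; for $\Phi,\Psi\in SV'$ put $[\Phi\Psi](\theta)=[\Phi\otimes\Psi](\Delta\theta)$, where $[\Phi\otimes\Psi](\xi\otimes\eta)=\Phi(\xi)\Psi(\eta)$. This makes $SV'$ a commutative associative algebra. Creators and annihilators: for $v\in V$, $c(v):SV\to SV$ is multiplication by $v$, and $a(v):SV\to SV$ is the unique linear derivation with $a(v)1=0$ and $a(v)w=\langle v|w\rangle$ for $w\in V$. They extend to $SV'$ by $[c(v)\Phi](\psi)=\Phi(a(v)\psi)$ and $[a(v)\Phi](\psi)=\Phi(c(v)\psi)$ for $\Phi\in SV'$, $\psi\in SV$. On $SV$ and on $SV'$ put $\pi(v)=\frac1{\sqrt2}\{c(v)+a(v)\}$.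 Symplectic group: $\Omega=\mathrm{Im}\langle\cdot|\cdot\rangle$; $\mathrm{Sp}(V)$ is the group of real-linear automorphisms $g$ of $V$ with $\Omega(gx,gy)=\Omega(x,y)$ for all $x,y\in V$. Put $C_g=\frac12(g-JgJ)$ (complex-linear) and $A_g=\frac12(g+JgJ)$ (antilinear), so $g=C_g+A_g$. $C_g$ is invertible, and $Z_g=-A_gC_g^{-1}$ is an antilinear operator on $V$ that is symmetric ($\langle y|Z_gx\rangle=\langle x|Z_gy\rangle$) with operator norm $<1$. For $v \in V$ put $c_g(v)=c(C_gv)+a(A_gv)$ and $a_g(v)=a(C_gv)+c(A_gv)$, on $SV$ and on $SV'$. Gaussian: let $\zeta_g\in SV'$ vanish on $S^dV$ for $d\ne2$ and satisfy $\zeta_g(xy)=\langle y|Z_gx\rangle$ for $x,y\in V$. Then $e^{Z_g}=\exp(\zeta_g)=\sum_{n\in\mathbb N}\zeta_g^n/n!\in SV'$ (when evaluated on any element of $SV$ the sum is finite). A generalized Fock implementer for $g\in\mathrm{Sp}(V)$ is a nonzero linear map $U:SV\to SV'$ such that $U\pi(v)=\pi(gv)U$ for all $v\in V$, where $\pi(v)$ acts on $SV$ and $\pi(gv)$ acts on $SV'$. *)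

theory Defs
  imports "HOL-Analysis.Analysis" "HOL-Library.Poly_Mapping" "HOL-Library.Multiset"
begin

section \<open>Complex vector spaces, Hilbert spaces and commutative algebras\<close>

class complex_vector = ab_group_add +
  fixes scaleC :: "complex \<Rightarrow> 'a \<Rightarrow> 'a"  (infixr \<open>*\<^sub>C\<close> 75)
  assumes scaleC_add_right: "c *\<^sub>C (x + y) = c *\<^sub>C x + c *\<^sub>C y"
    and scaleC_add_left: "(c + d) *\<^sub>C x = c *\<^sub>C x + d *\<^sub>C x"
    and scaleC_scaleC: "c *\<^sub>C d *\<^sub>C x = (c * d) *\<^sub>C x"
    and scaleC_one: "1 *\<^sub>C x = x"

global_interpretation cvs: vector_space "scaleC :: complex \<Rightarrow> 'a \<Rightarrow> 'a::complex_vector"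
  by unfold_locales (rule scaleC_add_right scaleC_add_left scaleC_scaleC scaleC_one)+

global_interpretation cvs_pair: vector_space_pair
  "scaleC :: complex \<Rightarrow> 'a \<Rightarrow> 'a::complex_vector" "scaleC :: complex \<Rightarrow> 'b \<Rightarrow> 'b::complex_vector"
  by unfold_locales

abbreviation clinear :: "('a::complex_vector \<Rightarrow> 'b::complex_vector) \<Rightarrow> bool" where
  "clinear \<equiv> Vector_Spaces.linear scaleC scaleC"

definition antilinear :: "('a::complex_vector \<Rightarrow> 'b::complex_vector) \<Rightarrow> bool" where
  "antilinear f \<longleftrightarrow> (\<forall>x y. f (x + y) = f x + f y) \<and> (\<forall>c x. f (c *\<^sub>C x) = cnj c *\<^sub>C f x)"

lemma clinearI:
  assumes "\<And>x y. f (x + y) = f x + f y" "\<And>c x. f (c *\<^sub>C x) = c *\<^sub>C f x"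
  shows "clinear f"
  using assms by unfold_locales

lemma clinear_add: "clinear f \<Longrightarrow> f (x + y) = f x + f y"
  by (rule cvs_pair.linear_add)

lemma clinear_scale: "clinear f \<Longrightarrow> f (c *\<^sub>C x) = c *\<^sub>C f x"
  by (rule cvs_pair.linear_scale)

lemma clinear_0: "clinear f \<Longrightarrow> f 0 = 0"
  by (rule cvs_pair.linear_0)

lemma clinear_diff: "clinear f \<Longrightarrow> f (x - y) = f x - f y"
  by (rule cvs_pair.linear_diff)

lemma clinear_sum: "clinear f \<Longrightarrow> f (sum h A) = (\<Sum>i\<in>A. f (h i))"
  by (rule cvs_pair.linear_sum)

instantiation complex :: complex_vector
begin
definition scaleC_complex :: "complex \<Rightarrow> complex \<Rightarrow> complex" where
  "scaleC_complex c z = c * z"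
instance by standard (simp_all add: scaleC_complex_def algebra_simps)
end

text \<open>The inner product is antilinear in the first slot and linear in the second; antilinearity in
  the first slot follows from the symmetry axiom.  Completeness is part of \<^class>\<open>banach\<close>.\<close>

class complex_hilbert = complex_vector + banach +
  fixes cinner :: "'a \<Rightarrow> 'a \<Rightarrow> complex"
  assumes scaleR_scaleC: "r *\<^sub>R x = complex_of_real r *\<^sub>C x"
    and cinner_add_right: "cinner x (y + z) = cinner x y + cinner x z"
    and cinner_scaleC_right: "cinner x (c *\<^sub>C y) = c * cinner x y"
    and cinner_commute: "cinner y x = cnj (cinner x y)"
    and cinner_self: "cinner x x = complex_of_real ((norm x)\<^sup>2)"

instantiation complex :: complex_hilbert
begin
definition cinner_complex :: "complex \<Rightarrow> complex \<Rightarrow> complex" where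
  "cinner_complex x y = cnj x * y"
instance
  by standard
    (auto simp: cinner_complex_def scaleC_complex_def scaleR_conv_of_real algebra_simps
      simp flip: complex_norm_square)
end

class comm_calgebra = comm_ring + comm_monoid_mult + complex_vector +
  assumes scaleC_mult_left: "c *\<^sub>C x * y = c *\<^sub>C (x * y)"
begin

lemma scaleC_mult_right: "x * c *\<^sub>C y = c *\<^sub>C (x * y)"
  using scaleC_mult_left[of c y x] by (simp add: mult.commute)

end

instance complex :: comm_calgebra
  by standard (simp add: scaleC_complex_def)


section \<open>The free complex vector space on a type\<close>

instantiation poly_mapping :: (type, complex_vector) complex_vector
begin
definition scaleC_poly_mapping :: "complex \<Rightarrow> ('a \<Rightarrow>\<^sub>0 'b) \<Rightarrow> 'a \<Rightarrow>\<^sub>0 'b" where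
  "scaleC_poly_mapping c p = Poly_Mapping.map (scaleC c) p"

lemma lookup_scaleC: "Poly_Mapping.lookup (c *\<^sub>C p) k = c *\<^sub>C Poly_Mapping.lookup p k"
  for p :: "'a \<Rightarrow>\<^sub>0 'b"
  by (simp add: scaleC_poly_mapping_def Poly_Mapping.map.rep_eq when_def)

instance
  by standard
    (auto intro!: poly_mapping_eqI simp: lookup_scaleC Poly_Mapping.lookup_add
      scaleC_add_left scaleC_add_right)
end

lemma poly_mapping_sum_single: "p = (\<Sum>k\<in>Poly_Mapping.keys p. Poly_Mapping.single k (Poly_Mapping.lookup p k))"
proof (rule poly_mapping_eqI)
  fix k
  have "(\<Sum>i\<in>Poly_Mapping.keys p. Poly_Mapping.lookup (Poly_Mapping.single i (Poly_Mapping.lookup p i)) k)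
      = (\<Sum>i\<in>Poly_Mapping.keys p. if i = k then Poly_Mapping.lookup p i else 0)"
    by (rule sum.cong) (auto simp: lookup_single when_def)
  then show "Poly_Mapping.lookup p k = Poly_Mapping.lookup (\<Sum>k\<in>Poly_Mapping.keys p. Poly_Mapping.single k (Poly_Mapping.lookup p k)) k"
    by (simp add: lookup_sum sum.delta in_keys_iff)
qed

definition free_lift :: "('k \<Rightarrow> 'a) \<Rightarrow> ('k \<Rightarrow>\<^sub>0 complex) \<Rightarrow> 'a::complex_vector" where
  "free_lift f p = (\<Sum>k\<in>Poly_Mapping.keys p. Poly_Mapping.lookup p k *\<^sub>C f k)"

lemma free_lift_superset:
  "finite A \<Longrightarrow> Poly_Mapping.keys p \<subseteq> A \<Longrightarrow> free_lift f p = (\<Sum>k\<in>A. Poly_Mapping.lookup p k *\<^sub>C f k)"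
  unfolding free_lift_def by (rule sum.mono_neutral_left) (auto simp: in_keys_iff)

lemma clinear_free_lift: "clinear (free_lift f)" for f :: "'k \<Rightarrow> 'a::complex_vector"
proof (rule clinearI)
  fix p q :: "'k \<Rightarrow>\<^sub>0 complex"
  have 1: "Poly_Mapping.keys (p + q) \<subseteq> Poly_Mapping.keys p \<union> Poly_Mapping.keys q" by (rule keys_add)
  show "free_lift f (p + q) = free_lift f p + free_lift f q"
    by (simp add: free_lift_superset[of "Poly_Mapping.keys p \<union> Poly_Mapping.keys q"] 1 lookup_add scaleC_add_left
        sum.distrib)
next
  fix c and p :: "'k \<Rightarrow>\<^sub>0 complex"
  have "Poly_Mapping.keys (c *\<^sub>C p) \<subseteq> Poly_Mapping.keys p" by (auto simp: in_keys_iff lookup_scaleC)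
  then show "free_lift f (c *\<^sub>C p) = c *\<^sub>C free_lift f p"
    by (simp add: free_lift_superset[of "Poly_Mapping.keys p"] lookup_scaleC scaleC_complex_def
        cvs.scale_sum_right)
qed

lemma free_lift_single: "free_lift f (Poly_Mapping.single k c) = c *\<^sub>C f k"
  by (cases "c = 0") (simp_all add: free_lift_def)

lemma clinear_eq_on_singles:
  fixes f g :: "('k \<Rightarrow>\<^sub>0 complex) \<Rightarrow> 'a::complex_vector"
  assumes f: "clinear f" and g: "clinear g"
    and eq: "\<And>k. f (Poly_Mapping.single k 1) = g (Poly_Mapping.single k 1)"
  shows "f p = g p"
proof -
  have s: "Poly_Mapping.single k c = c *\<^sub>C Poly_Mapping.single k (1::complex)" for k :: 'k and c
    by (rule poly_mapping_eqI) (auto simp: lookup_scaleC lookup_single when_def scaleC_complex_def)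
  have "f p = (\<Sum>k\<in>Poly_Mapping.keys p. f (Poly_Mapping.single k (Poly_Mapping.lookup p k)))"
    by (subst poly_mapping_sum_single) (rule clinear_sum[OF f])
  also have "\<dots> = (\<Sum>k\<in>Poly_Mapping.keys p. g (Poly_Mapping.single k (Poly_Mapping.lookup p k)))"
    by (subst (1 2) s) (simp add: clinear_scale[OF f] clinear_scale[OF g] eq)
  also have "\<dots> = g p"
    by (subst (2) poly_mapping_sum_single) (rule clinear_sum[OF g, symmetric])
  finally show ?thesis .
qed


section \<open>The tensor product of two complex vector spaces\<close>

definition tensor_relators :: "(('a::complex_vector \<times> 'b::complex_vector) \<Rightarrow>\<^sub>0 complex) set" where
  "tensor_relators =
     {Poly_Mapping.single (x + x', y) 1 - Poly_Mapping.single (x, y) 1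
        - Poly_Mapping.single (x', y) 1 |x x' y. True} \<union>
     {Poly_Mapping.single (x, y + y') 1 - Poly_Mapping.single (x, y) 1
        - Poly_Mapping.single (x, y') 1 |x y y'. True} \<union>
     {Poly_Mapping.single (c *\<^sub>C x, y) 1 - Poly_Mapping.single (x, y) c |c x y. True} \<union>
     {Poly_Mapping.single (x, c *\<^sub>C y) 1 - Poly_Mapping.single (x, y) c |c x y. True}"

definition tensor_rel where
  "tensor_rel p q \<longleftrightarrow> p - q \<in> cvs.span tensor_relators"

lemma equivp_tensor_rel: "equivp tensor_rel"
proof (rule equivpI)
  show "reflp tensor_rel" by (auto simp: reflp_def tensor_rel_def cvs.span_zero)
  show "symp tensor_rel"
    unfolding symp_def tensor_rel_def by (metis cvs.span_neg minus_diff_eq)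
  show "transp tensor_rel"
  proof (rule transpI)
    fix p q r assume "tensor_rel p q" "tensor_rel q r"
    then have "(p - q) + (q - r) \<in> cvs.span tensor_relators"
      unfolding tensor_rel_def by (rule cvs.span_add)
    then show "tensor_rel p r" by (simp add: tensor_rel_def)
  qed
qed

quotient_type (overloaded) ('a, 'b) tensor =
  "('a::complex_vector \<times> 'b::complex_vector) \<Rightarrow>\<^sub>0 complex" / tensor_rel
  by (rule equivp_tensor_rel)

instantiation tensor :: (complex_vector, complex_vector) complex_vector
begin

lift_definition zero_tensor :: "('a, 'b) tensor" is 0 .
lift_definition plus_tensor :: "('a, 'b) tensor \<Rightarrow> ('a, 'b) tensor \<Rightarrow> ('a, 'b) tensor" is "(+)"
  unfolding tensor_rel_def by (metis add_diff_add cvs.span_add)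
lift_definition minus_tensor :: "('a, 'b) tensor \<Rightarrow> ('a, 'b) tensor \<Rightarrow> ('a, 'b) tensor" is "(-)"
proof -
  fix p p' q q' :: "('a \<times> 'b) \<Rightarrow>\<^sub>0 complex"
  assume "tensor_rel p p'" "tensor_rel q q'"
  then have "(p - p') - (q - q') \<in> cvs.span tensor_relators"
    unfolding tensor_rel_def by (rule cvs.span_diff)
  then show "tensor_rel (p - q) (p' - q')" by (simp add: tensor_rel_def algebra_simps)
qed
lift_definition uminus_tensor :: "('a, 'b) tensor \<Rightarrow> ('a, 'b) tensor" is uminus
  unfolding tensor_rel_def by (metis cvs.span_neg minus_diff_minus)
lift_definition scaleC_tensor :: "complex \<Rightarrow> ('a, 'b) tensor \<Rightarrow> ('a, 'b) tensor" is scaleC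
  unfolding tensor_rel_def by (metis cvs.span_scale cvs.scale_right_diff_distrib)

instance
proof
  fix a b c :: "('a, 'b) tensor" and r s :: complex
  have e: "p = q \<Longrightarrow> tensor_rel p q" for p q :: "('a \<times> 'b) \<Rightarrow>\<^sub>0 complex"
    by (simp add: tensor_rel_def cvs.span_zero)
  show "a + b + c = a + (b + c)" by transfer (rule e, simp)
  show "a + b = b + a" by transfer (rule e, simp)
  show "0 + a = a" by transfer (rule e, simp)
  show "- a + a = 0" by transfer (rule e, simp)
  show "a - b = a + - b" by transfer (rule e, simp)
  show "r *\<^sub>C (a + b) = r *\<^sub>C a + r *\<^sub>C b" by transfer (rule e, rule scaleC_add_right)
  show "(r + s) *\<^sub>C a = r *\<^sub>C a + s *\<^sub>C a" by transfer (rule e, rule scaleC_add_left)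
  show "r *\<^sub>C s *\<^sub>C a = (r * s) *\<^sub>C a" by transfer (rule e, rule scaleC_scaleC)
  show "1 *\<^sub>C a = a" by transfer (rule e, rule scaleC_one)
qed

end

lift_definition tensor_pure :: "'a \<Rightarrow> 'b \<Rightarrow> ('a::complex_vector, 'b::complex_vector) tensor"
  (infixl \<open>\<otimes>\<^sub>t\<close> 72) is "\<lambda>x y. Poly_Mapping.single (x, y) 1" .

lemma tensor_pure_add_left: "(x + x') \<otimes>\<^sub>t y = x \<otimes>\<^sub>t y + x' \<otimes>\<^sub>t y"
  apply transfer
  unfolding tensor_rel_def diff_diff_eq[symmetric]
  by (rule cvs.span_base) (unfold tensor_relators_def, blast)

lemma tensor_pure_add_right: "x \<otimes>\<^sub>t (y + y') = x \<otimes>\<^sub>t y + x \<otimes>\<^sub>t y'"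
  apply transfer
  unfolding tensor_rel_def diff_diff_eq[symmetric]
  by (rule cvs.span_base) (unfold tensor_relators_def, blast)

lemma scaleC_single: "c *\<^sub>C Poly_Mapping.single k d = Poly_Mapping.single k (c * d :: complex)"
  by (rule poly_mapping_eqI) (auto simp: lookup_scaleC lookup_single when_def scaleC_complex_def)

lemma tensor_pure_scale_left: "(c *\<^sub>C x) \<otimes>\<^sub>t y = c *\<^sub>C (x \<otimes>\<^sub>t y)"
  apply transfer
  unfolding tensor_rel_def scaleC_single mult_1_right
  by (rule cvs.span_base) (unfold tensor_relators_def, blast)

lemma tensor_pure_scale_right: "x \<otimes>\<^sub>t (c *\<^sub>C y) = c *\<^sub>C (x \<otimes>\<^sub>t y)"
  apply transfer
  unfolding tensor_rel_def scaleC_single mult_1_right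
  by (rule cvs.span_base) (unfold tensor_relators_def, blast)

definition cbilinear :: "('a::complex_vector \<Rightarrow> 'b::complex_vector \<Rightarrow> 'c::complex_vector) \<Rightarrow> bool" where
  "cbilinear f \<longleftrightarrow> (\<forall>x. clinear (f x)) \<and> (\<forall>y. clinear (\<lambda>x. f x y))"

lemma cbilinear_tensor_pure: "cbilinear (\<otimes>\<^sub>t)"
  unfolding cbilinear_def
  by (auto intro!: clinearI simp: tensor_pure_add_left tensor_pure_add_right
      tensor_pure_scale_left tensor_pure_scale_right)

text \<open>The linear map on the tensor product induced by a bilinear map.\<close>

definition tensor_lift ::
  "('a \<Rightarrow> 'b \<Rightarrow> 'c) \<Rightarrow> ('a::complex_vector, 'b::complex_vector) tensor \<Rightarrow> 'c::complex_vector" where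
  "tensor_lift f t = free_lift (\<lambda>(x, y). f x y) (rep_tensor t)"

lemma free_lift_tensor_rel:
  assumes f: "cbilinear f" and r: "tensor_rel p q"
  shows "free_lift (\<lambda>(x, y). f x y) p = free_lift (\<lambda>(x, y). f x y) q"
proof -
  let ?F = "free_lift (\<lambda>(x, y). f x y)"
  note l = clinear_free_lift[of "\<lambda>(x, y). f x y"]
  have b: "clinear (f x)" "clinear (\<lambda>x. f x y)" for x y
    using f by (auto simp: cbilinear_def)
  have z: "?F r = 0" if "r \<in> tensor_relators" for r
    using that unfolding tensor_relators_def
    by (auto simp: clinear_diff[OF l] free_lift_single clinear_add[OF b(1)] clinear_scale[OF b(1)]
        clinear_add[OF b(2)] clinear_scale[OF b(2)])
  have "?F (p - q) = 0"
    using r unfolding tensor_rel_def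
    by (rule cvs_pair.linear_eq_0_on_span[OF l z, rotated])
  then show ?thesis by (simp add: clinear_diff[OF l])
qed

lemma tensor_lift_abs: "cbilinear f \<Longrightarrow> tensor_lift f (abs_tensor p) = free_lift (\<lambda>(x, y). f x y) p"
  unfolding tensor_lift_def
  by (rule free_lift_tensor_rel)
    (auto simp: Quotient3_tensor[THEN Quotient3_rel_rep] intro: rep_abs_rsp_left[OF Quotient3_tensor] equivp_reflp[OF equivp_tensor_rel])

lemma abs_tensor_exhaust: obtains p where "t = abs_tensor p"
  using Quotient3_abs_rep[OF Quotient3_tensor, of t] by metis

lemma clinear_tensor_lift:
  assumes "cbilinear f" shows "clinear (tensor_lift f)"
proof (rule clinearI)
  fix s t :: "('a, 'b) tensor" and c
  obtain p q where s: "s = abs_tensor p" and t: "t = abs_tensor q" using abs_tensor_exhaust by metis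
  show "tensor_lift f (s + t) = tensor_lift f s + tensor_lift f t"
    unfolding s t plus_tensor.abs_eq tensor_lift_abs[OF assms] by (rule clinear_add[OF clinear_free_lift])
  show "tensor_lift f (c *\<^sub>C s) = c *\<^sub>C tensor_lift f s"
    unfolding s scaleC_tensor.abs_eq tensor_lift_abs[OF assms] by (rule clinear_scale[OF clinear_free_lift])
qed

lemma tensor_lift_pure: "cbilinear f \<Longrightarrow> tensor_lift f (x \<otimes>\<^sub>t y) = f x y"
  by (simp add: tensor_pure.abs_eq tensor_lift_abs free_lift_single)

lemma clinear_abs_tensor: "clinear abs_tensor"
  by (rule clinearI) (simp_all add: plus_tensor.abs_eq scaleC_tensor.abs_eq)

lemma tensor_ext:
  fixes f g :: "('a::complex_vector, 'b::complex_vector) tensor \<Rightarrow> 'c::complex_vector"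
  assumes f: "clinear f" and g: "clinear g" and eq: "\<And>x y. f (x \<otimes>\<^sub>t y) = g (x \<otimes>\<^sub>t y)"
  shows "f t = g t"
proof -
  obtain p where t: "t = abs_tensor p" by (rule abs_tensor_exhaust)
  have "(f \<circ> abs_tensor) p = (g \<circ> abs_tensor) p"
    by (rule clinear_eq_on_singles[OF Vector_Spaces.linear_compose[OF clinear_abs_tensor f]
          Vector_Spaces.linear_compose[OF clinear_abs_tensor g]])
      (clarsimp simp: eq simp flip: tensor_pure.abs_eq)
  then show ?thesis by (simp add: t)
qed

lemma clinear_mult_left: "clinear (\<lambda>x. x * y)" for y :: "'a::comm_calgebra"
  by (rule clinearI) (simp_all add: distrib_right scaleC_mult_left)

lemma clinear_mult_right: "clinear (\<lambda>y. x * y)" for x :: "'a::comm_calgebra"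
  by (rule clinearI) (simp_all add: distrib_left scaleC_mult_right)

subsection \<open>The tensor product of commutative algebras is a commutative algebra\<close>

lemma cbilinear_times_pure:
  "cbilinear (\<lambda>c d. (a * c) \<otimes>\<^sub>t (b * d))" for a :: "'a::comm_calgebra" and b :: "'b::comm_calgebra"
  unfolding cbilinear_def
  by (auto intro!: clinearI simp: distrib_left scaleC_mult_right tensor_pure_add_left
      tensor_pure_add_right tensor_pure_scale_left tensor_pure_scale_right)

lemma clinear_add_fun: "clinear f \<Longrightarrow> clinear g \<Longrightarrow> clinear (\<lambda>x. f x + g x)"
  by (rule cvs_pair.linear_compose_add)

lemma clinear_scale_fun: "clinear f \<Longrightarrow> clinear (\<lambda>x. c *\<^sub>C f x)"
  by (rule cvs_pair.linear_compose_scale_right)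

lemma cbilinear_times_tensor:
  "cbilinear (\<lambda>a b. tensor_lift (\<lambda>c d. (a * c) \<otimes>\<^sub>t (b * d)) t)"
  for t :: "('a::comm_calgebra, 'b::comm_calgebra) tensor"
  unfolding cbilinear_def
proof (intro conjI allI clinearI)
  fix a a' :: 'a and b b' :: 'b and k
  note l = clinear_tensor_lift[OF cbilinear_times_pure]
  show "tensor_lift (\<lambda>c d. (a * c) \<otimes>\<^sub>t ((b + b') * d)) t =
      tensor_lift (\<lambda>c d. (a * c) \<otimes>\<^sub>t (b * d)) t + tensor_lift (\<lambda>c d. (a * c) \<otimes>\<^sub>t (b' * d)) t"
    by (rule tensor_ext[OF l clinear_add_fun[OF l l]])
      (simp only: tensor_lift_pure[OF cbilinear_times_pure], simp add: distrib_right tensor_pure_add_right)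
  show "tensor_lift (\<lambda>c d. ((a + a') * c) \<otimes>\<^sub>t (b * d)) t =
      tensor_lift (\<lambda>c d. (a * c) \<otimes>\<^sub>t (b * d)) t + tensor_lift (\<lambda>c d. (a' * c) \<otimes>\<^sub>t (b * d)) t"
    by (rule tensor_ext[OF l clinear_add_fun[OF l l]])
      (simp only: tensor_lift_pure[OF cbilinear_times_pure], simp add: distrib_right tensor_pure_add_left)
  show "tensor_lift (\<lambda>c d. (a * c) \<otimes>\<^sub>t ((k *\<^sub>C b) * d)) t =
      k *\<^sub>C tensor_lift (\<lambda>c d. (a * c) \<otimes>\<^sub>t (b * d)) t"
    by (rule tensor_ext[OF l clinear_scale_fun[OF l]])
      (simp only: tensor_lift_pure[OF cbilinear_times_pure], simp add: scaleC_mult_left tensor_pure_scale_right)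
  show "tensor_lift (\<lambda>c d. ((k *\<^sub>C a) * c) \<otimes>\<^sub>t (b * d)) t =
      k *\<^sub>C tensor_lift (\<lambda>c d. (a * c) \<otimes>\<^sub>t (b * d)) t"
    by (rule tensor_ext[OF l clinear_scale_fun[OF l]])
      (simp only: tensor_lift_pure[OF cbilinear_times_pure], simp add: scaleC_mult_left tensor_pure_scale_left)
qed

instantiation tensor :: (comm_calgebra, comm_calgebra) comm_calgebra
begin

definition one_tensor :: "('a, 'b) tensor" where
  "one_tensor = 1 \<otimes>\<^sub>t 1"

definition times_tensor :: "('a, 'b) tensor \<Rightarrow> ('a, 'b) tensor \<Rightarrow> ('a, 'b) tensor" where
  "times_tensor s t = tensor_lift (\<lambda>a b. tensor_lift (\<lambda>c d. (a * c) \<otimes>\<^sub>t (b * d)) t) s"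

lemma clinear_times_tensor_left: "clinear (\<lambda>s. s * t)" for t :: "('a, 'b) tensor"
  unfolding times_tensor_def by (rule clinear_tensor_lift[OF cbilinear_times_tensor])

lemma tensor_pure_mult: "(a \<otimes>\<^sub>t b) * (c \<otimes>\<^sub>t d) = (a * c) \<otimes>\<^sub>t (b * d)" for a c :: 'a and b d :: 'b
  unfolding times_tensor_def tensor_lift_pure[OF cbilinear_times_tensor]
  by (rule tensor_lift_pure[OF cbilinear_times_pure])

lemma clinear_times_tensor_right: "clinear (\<lambda>t. s * t)" for s :: "('a, 'b) tensor"
proof (rule clinearI)
  fix t t' :: "('a, 'b) tensor" and k
  note l = clinear_times_tensor_left
  note l' = clinear_tensor_lift[OF cbilinear_times_pure]
  show "s * (t + t') = s * t + s * t'"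
    by (rule tensor_ext[OF l clinear_add_fun[OF l l]])
      (simp only: times_tensor_def tensor_lift_pure[OF cbilinear_times_tensor], rule clinear_add[OF l'])
  show "s * (k *\<^sub>C t) = k *\<^sub>C (s * t)"
    by (rule tensor_ext[OF l clinear_scale_fun[OF l]])
      (simp only: times_tensor_def tensor_lift_pure[OF cbilinear_times_tensor], rule clinear_scale[OF l'])
qed

instance
proof
  note l = clinear_times_tensor_left and r = clinear_times_tensor_right
  note c = Vector_Spaces.linear_compose[unfolded o_def]
  fix s t u :: "('a, 'b) tensor" and k :: complex
  show comm: "s * t = t * s" for s t :: "('a, 'b) tensor"
  proof (rule tensor_ext[OF l r])
    show "(x \<otimes>\<^sub>t y) * t = t * (x \<otimes>\<^sub>t y)" for x y
      by (rule tensor_ext[OF r l]) (simp add: tensor_pure_mult mult.commute)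
  qed
  show "s * t * u = s * (t * u)"
  proof (rule tensor_ext[of "\<lambda>s. s * t * u"])
    show "(x \<otimes>\<^sub>t y) * t * u = (x \<otimes>\<^sub>t y) * (t * u)" for x y
    proof (rule tensor_ext[of "\<lambda>t. (x \<otimes>\<^sub>t y) * t * u"])
      show "(x \<otimes>\<^sub>t y) * (x' \<otimes>\<^sub>t y') * u = (x \<otimes>\<^sub>t y) * ((x' \<otimes>\<^sub>t y') * u)" for x' y'
        by (rule tensor_ext[OF r c[OF r r]]) (simp add: tensor_pure_mult mult.assoc)
    qed (intro c[OF r l] c[OF l r])+
  qed (intro c[OF l l] l)+
  show "(s + t) * u = s * u + t * u" by (rule clinear_add[OF l])
  show "1 * s = s"
    unfolding one_tensor_def
    by (rule tensor_ext[OF r cvs.linear_ident]) (simp add: tensor_pure_mult)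
  show "k *\<^sub>C s * t = k *\<^sub>C (s * t)" by (rule clinear_scale[OF l])
qed

end


section \<open>The symmetric algebra\<close>

text \<open>Finitely supported functions on the multisets over \<open>V\<close> are the polynomials with one
  indeterminate for every vector of \<open>V\<close>; \<open>SV\<close> is the quotient by the ideal which makes the passage
  from a vector to its indeterminate linear.\<close>

abbreviation indet :: "'v \<Rightarrow> 'v multiset \<Rightarrow>\<^sub>0 complex" where
  "indet v \<equiv> Poly_Mapping.single {#v#} 1"

definition sym_relators :: "('v::complex_vector multiset \<Rightarrow>\<^sub>0 complex) set" where
  "sym_relators =
     {indet (v + w) - indet v - indet w |v w. True} \<union>
     {indet (c *\<^sub>C v) - c *\<^sub>C indet v |c v. True}"

text \<open>The span over the ring itself, that is, the generated ideal.\<close>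

definition sym_ideal :: "('v::complex_vector multiset \<Rightarrow>\<^sub>0 complex) set" where
  "sym_ideal = module.span (*) sym_relators"

lemma module_times: "module ((*) :: 'a \<Rightarrow> 'a \<Rightarrow> 'a::comm_ring_1)"
  by unfold_locales (simp_all add: algebra_simps)

lemma scaleC_conv_mult: "c *\<^sub>C p = Poly_Mapping.single 0 c * p"
  for p :: "'k::monoid_add \<Rightarrow>\<^sub>0 complex"
proof -
  have "scaleC c = ((*) c :: complex \<Rightarrow> complex)" by (simp add: fun_eq_iff scaleC_complex_def)
  then show ?thesis by (simp add: scaleC_poly_mapping_def mult_map_scale_conv_mult)
qed

lemma sym_ideal_0: "0 \<in> sym_ideal"
  and sym_ideal_add: "p \<in> sym_ideal \<Longrightarrow> q \<in> sym_ideal \<Longrightarrow> p + q \<in> sym_ideal"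
  and sym_ideal_diff: "p \<in> sym_ideal \<Longrightarrow> q \<in> sym_ideal \<Longrightarrow> p - q \<in> sym_ideal"
  and sym_ideal_neg: "p \<in> sym_ideal \<Longrightarrow> - p \<in> sym_ideal"
  and sym_ideal_mult: "p \<in> sym_ideal \<Longrightarrow> r * p \<in> sym_ideal"
  and sym_ideal_base: "p \<in> sym_relators \<Longrightarrow> p \<in> sym_ideal"
  unfolding sym_ideal_def
  by (fact module.span_zero[OF module_times] module.span_add[OF module_times]
      module.span_diff[OF module_times] module.span_neg[OF module_times]
      module.span_scale[OF module_times] module.span_base[OF module_times])+

definition sym_rel where
  "sym_rel p q \<longleftrightarrow> p - q \<in> sym_ideal"

lemma equivp_sym_rel: "equivp sym_rel"
proof (rule equivpI)
  show "reflp sym_rel" by (auto simp: reflp_def sym_rel_def sym_ideal_0)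
  show "symp sym_rel"
    unfolding symp_def sym_rel_def by (metis sym_ideal_neg minus_diff_eq)
  show "transp sym_rel"
  proof (rule transpI)
    fix p q r assume "sym_rel p q" "sym_rel q r"
    then have "(p - q) + (q - r) \<in> sym_ideal"
      unfolding sym_rel_def by (rule sym_ideal_add)
    then show "sym_rel p r" by (simp add: sym_rel_def)
  qed
qed

quotient_type (overloaded) 'v symalg = "'v::complex_vector multiset \<Rightarrow>\<^sub>0 complex" / sym_rel
  by (rule equivp_sym_rel)

instantiation symalg :: (complex_vector) comm_calgebra
begin

lift_definition zero_symalg :: "'a symalg" is 0 .
lift_definition one_symalg :: "'a symalg" is 1 .
lift_definition plus_symalg :: "'a symalg \<Rightarrow> 'a symalg \<Rightarrow> 'a symalg" is "(+)"
  unfolding sym_rel_def by (metis add_diff_add sym_ideal_add)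
lift_definition minus_symalg :: "'a symalg \<Rightarrow> 'a symalg \<Rightarrow> 'a symalg" is "(-)"
proof -
  fix p p' q q' :: "'a multiset \<Rightarrow>\<^sub>0 complex"
  assume "sym_rel p p'" "sym_rel q q'"
  then have "(p - p') - (q - q') \<in> sym_ideal" unfolding sym_rel_def by (rule sym_ideal_diff)
  then show "sym_rel (p - q) (p' - q')" by (simp add: sym_rel_def algebra_simps)
qed
lift_definition uminus_symalg :: "'a symalg \<Rightarrow> 'a symalg" is uminus
  unfolding sym_rel_def by (metis sym_ideal_neg minus_diff_minus)
lift_definition times_symalg :: "'a symalg \<Rightarrow> 'a symalg \<Rightarrow> 'a symalg" is "(*)"
proof -
  fix p p' q q' :: "'a multiset \<Rightarrow>\<^sub>0 complex"
  assume "sym_rel p p'" "sym_rel q q'"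
  then have "q * (p - p') + p' * (q - q') \<in> sym_ideal"
    unfolding sym_rel_def by (intro sym_ideal_add sym_ideal_mult)
  then show "sym_rel (p * q) (p' * q')" by (simp add: sym_rel_def algebra_simps)
qed
lift_definition scaleC_symalg :: "complex \<Rightarrow> 'a symalg \<Rightarrow> 'a symalg" is scaleC
  unfolding sym_rel_def scaleC_conv_mult by (metis sym_ideal_mult right_diff_distrib)

instance
proof
  fix a b c :: "'a symalg" and r s :: complex
  have e: "p = q \<Longrightarrow> sym_rel p q" for p q :: "'a multiset \<Rightarrow>\<^sub>0 complex"
    by (simp add: sym_rel_def sym_ideal_0)
  show "a + b + c = a + (b + c)" by transfer (rule e, simp)
  show "a + b = b + a" by transfer (rule e, simp)
  show "0 + a = a" by transfer (rule e, simp)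
  show "- a + a = 0" by transfer (rule e, simp)
  show "a - b = a + - b" by transfer (rule e, simp)
  show "a * b * c = a * (b * c)" by transfer (rule e, simp add: mult.assoc)
  show "a * b = b * a" by transfer (rule e, simp add: mult.commute)
  show "1 * a = a" by transfer (rule e, simp)
  show "(a + b) * c = a * c + b * c" by transfer (rule e, simp add: distrib_right)
  show "r *\<^sub>C (a + b) = r *\<^sub>C a + r *\<^sub>C b" by transfer (rule e, rule scaleC_add_right)
  show "(r + s) *\<^sub>C a = r *\<^sub>C a + s *\<^sub>C a" by transfer (rule e, rule scaleC_add_left)
  show "r *\<^sub>C s *\<^sub>C a = (r * s) *\<^sub>C a" by transfer (rule e, rule scaleC_scaleC)
  show "1 *\<^sub>C a = a" by transfer (rule e, rule scaleC_one)
  show "r *\<^sub>C a * b = r *\<^sub>C (a * b)" by transfer (rule e, simp add: scaleC_conv_mult mult.assoc)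
qed

end

text \<open>The canonical map \<open>V \<rightarrow> SV\<close>.\<close>

lift_definition emb :: "'v::complex_vector \<Rightarrow> 'v symalg" is indet .

lemma clinear_emb: "clinear (emb :: 'v \<Rightarrow> 'v::complex_vector symalg)"
proof (rule clinearI)
  fix v w :: 'v and c
  show "emb (v + w) = emb v + emb w"
    apply transfer
    unfolding sym_rel_def diff_diff_eq[symmetric]
    by (rule sym_ideal_base) (auto simp: sym_relators_def)
  show "emb (c *\<^sub>C v) = c *\<^sub>C emb v"
    apply transfer
    unfolding sym_rel_def
    by (rule sym_ideal_base) (auto simp: sym_relators_def)
qed

lemma clinear_abs_symalg: "clinear abs_symalg"
  by (rule clinearI) (simp_all add: plus_symalg.abs_eq scaleC_symalg.abs_eq)

lemma abs_symalg_exhaust: obtains p where "x = abs_symalg p"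
  using Quotient3_abs_rep[OF Quotient3_symalg, of x] by metis

lemma abs_symalg_monom: "abs_symalg (Poly_Mapping.single m 1) = (\<Prod>v\<in>#m. emb v)"
proof (induction m)
  case empty
  then show ?case by (simp add: one_symalg.abs_eq)
next
  case (add v m)
  have "abs_symalg (Poly_Mapping.single (add_mset v m) 1) =
      emb v * abs_symalg (Poly_Mapping.single m 1)"
    by (simp add: mult_single emb.abs_eq times_symalg.abs_eq)
  then show ?case by (simp add: add.IH)
qed

lemma symalg_ext:
  fixes f g :: "'v::complex_vector symalg \<Rightarrow> 'a::complex_vector"
  assumes f: "clinear f" and g: "clinear g"
    and eq: "\<And>m. f (\<Prod>v\<in>#m. emb v) = g (\<Prod>v\<in>#m. emb v)"
  shows "f x = g x"
proof -
  obtain p where x: "x = abs_symalg p" by (rule abs_symalg_exhaust)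
  have "(f \<circ> abs_symalg) p = (g \<circ> abs_symalg) p"
    by (rule clinear_eq_on_singles[OF Vector_Spaces.linear_compose[OF clinear_abs_symalg f]
          Vector_Spaces.linear_compose[OF clinear_abs_symalg g]])
      (simp add: eq abs_symalg_monom)
  then show ?thesis by (simp add: x)
qed

text \<open>A linear map on polynomials descends to \<open>SV\<close> as soon as it kills all products of a monomial
  and a relator.\<close>

lemma free_lift_sym_rel:
  assumes z: "\<And>m r. r \<in> sym_relators \<Longrightarrow> free_lift f (Poly_Mapping.single m 1 * r) = 0"
    and pq: "sym_rel p q"
  shows "free_lift f p = free_lift f q"
proof -
  note l = clinear_free_lift[of f]
  note c = Vector_Spaces.linear_compose[unfolded o_def]
  have mr: "clinear (\<lambda>s. s * r)" for r :: "'a multiset \<Rightarrow>\<^sub>0 complex"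
    by (rule clinearI) (simp_all add: distrib_right scaleC_conv_mult mult.assoc)
  have z': "free_lift f (s * r) = 0" if "r \<in> sym_relators" for s r
    using clinear_eq_on_singles[OF c[OF mr[of r] l] cvs_pair.linear_zero] z[OF that] by simp
  have "p - q \<in> module.span (*) sym_relators"
    using pq by (simp add: sym_rel_def sym_ideal_def)
  then have "free_lift f (p - q) = 0"
    by (induction rule: module.span_induct_alt[OF module_times, consumes 1])
      (simp_all add: clinear_0[OF l] clinear_add[OF l] z')
  then show ?thesis by (simp add: clinear_diff[OF l])
qed

text \<open>The algebra homomorphism on \<open>SV\<close> induced by a linear map on \<open>V\<close>.\<close>

definition sym_lift :: "('v::complex_vector \<Rightarrow> 'a::comm_calgebra) \<Rightarrow> 'v symalg \<Rightarrow> 'a" where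
  "sym_lift f x = free_lift (\<lambda>m. \<Prod>v\<in>#m. f v) (rep_symalg x)"

lemma free_lift_monom_mult:
  "free_lift (\<lambda>m. \<Prod>v\<in>#m. f v) (Poly_Mapping.single m c * indet v) =
    c *\<^sub>C ((\<Prod>v\<in>#m. f v) * f v)" for f :: "'v::complex_vector \<Rightarrow> 'a::comm_calgebra"
  by (simp add: mult_single free_lift_single mult.commute)

lemma sym_lift_abs:
  assumes f: "clinear f"
  shows "sym_lift f (abs_symalg p) = free_lift (\<lambda>m. \<Prod>v\<in>#m. f v) p"
  unfolding sym_lift_def
proof (rule free_lift_sym_rel)
  let ?F = "free_lift (\<lambda>m. \<Prod>v\<in>#m. f v)"
  note l = clinear_free_lift[of "\<lambda>m. \<Prod>v\<in>#m. f v"]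
  have s: "x * c *\<^sub>C y = c *\<^sub>C (x * y)" for c and x y :: "'a multiset \<Rightarrow>\<^sub>0 complex"
    by (simp add: scaleC_conv_mult algebra_simps)
  show "?F (Poly_Mapping.single m 1 * r) = 0" if "r \<in> sym_relators" for m r
    using that unfolding sym_relators_def
    by (auto simp: right_diff_distrib s clinear_diff[OF l] clinear_scale[OF l] free_lift_monom_mult
        clinear_add[OF f] clinear_scale[OF f] distrib_left scaleC_mult_right scaleC_one
        simp del: mult_single)
  show "sym_rel (rep_symalg (abs_symalg p)) p"
    using rep_abs_rsp_left[OF Quotient3_symalg] equivp_reflp[OF equivp_sym_rel] by blast
qed

lemma clinear_sym_lift:
  assumes "clinear f" shows "clinear (sym_lift f)"
proof (rule clinearI)
  fix x y :: "'a symalg" and c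
  obtain p q where x: "x = abs_symalg p" and y: "y = abs_symalg q" using abs_symalg_exhaust by metis
  show "sym_lift f (x + y) = sym_lift f x + sym_lift f y"
    unfolding x y plus_symalg.abs_eq sym_lift_abs[OF assms] by (rule clinear_add[OF clinear_free_lift])
  show "sym_lift f (c *\<^sub>C x) = c *\<^sub>C sym_lift f x"
    unfolding x scaleC_symalg.abs_eq sym_lift_abs[OF assms] by (rule clinear_scale[OF clinear_free_lift])
qed

lemma sym_lift_monom: "clinear f \<Longrightarrow> sym_lift f (\<Prod>v\<in>#m. emb v) = (\<Prod>v\<in>#m. f v)"
  by (simp add: abs_symalg_monom[symmetric] sym_lift_abs free_lift_single scaleC_one)

lemma sym_lift_emb: "clinear f \<Longrightarrow> sym_lift f (emb v) = f v"
  using sym_lift_monom[of f "{#v#}"] by simp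

lemma sym_lift_one: "clinear f \<Longrightarrow> sym_lift f 1 = 1"
  using sym_lift_monom[of f "{#}"] by simp

lemma sym_lift_mult:
  assumes f: "clinear f" shows "sym_lift f (x * y) = sym_lift f x * sym_lift f y"
proof -
  note l = clinear_sym_lift[OF f]
  note c = Vector_Spaces.linear_compose[unfolded o_def]
  show ?thesis
  proof (rule symalg_ext[of "\<lambda>x. sym_lift f (x * y)"])
    fix m
    show "sym_lift f ((\<Prod>v\<in>#m. emb v) * y) = sym_lift f (\<Prod>v\<in>#m. emb v) * sym_lift f y"
    proof (rule symalg_ext[of "\<lambda>y. sym_lift f ((\<Prod>v\<in>#m. emb v) * y)"])
      fix m'
      have "(\<Prod>v\<in>#m. emb v) * (\<Prod>v\<in>#m'. emb v) = (\<Prod>v\<in>#m + m'. emb v)" by simp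
      then show "sym_lift f ((\<Prod>v\<in>#m. emb v) * (\<Prod>v\<in>#m'. emb v)) =
          sym_lift f (\<Prod>v\<in>#m. emb v) * sym_lift f (\<Prod>v\<in>#m'. emb v)"
        by (simp only: sym_lift_monom[OF f]) simp
    qed (intro c[OF clinear_mult_right l] c[OF l clinear_mult_right])+
  qed (intro c[OF clinear_mult_left l] c[OF l clinear_mult_left])+
qed


abbreviation sym_monom :: "'v::complex_vector multiset \<Rightarrow> 'v symalg" where
  "sym_monom m \<equiv> (\<Prod>v\<in>#m. emb v)"

text \<open>The subspace \<open>S\<^sup>dV\<close>.\<close>

definition sym_grade :: "nat \<Rightarrow> 'v::complex_vector symalg set" where
  "sym_grade d = cvs.span {prod_list (map emb vs) |vs. length vs = d}"


section \<open>Creators and annihilators on \<open>SV\<close>\<close>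

definition creator :: "'v::complex_hilbert \<Rightarrow> 'v symalg \<Rightarrow> 'v symalg" where
  "creator v \<psi> = emb v * \<psi>"

definition is_derivation_extending ::
  "('v::complex_vector \<Rightarrow> complex) \<Rightarrow> ('v symalg \<Rightarrow> 'v symalg) \<Rightarrow> bool" where
  "is_derivation_extending f D \<longleftrightarrow>
     clinear D \<and> (\<forall>\<phi> \<psi>. D (\<phi> * \<psi>) = D \<phi> * \<psi> + \<phi> * D \<psi>) \<and>
     D 1 = 0 \<and> (\<forall>w. D (emb w) = f w *\<^sub>C 1)"

definition annihilator :: "'v::complex_hilbert \<Rightarrow> 'v symalg \<Rightarrow> 'v symalg" where
  "annihilator v = (THE D. is_derivation_extending (cinner v) D)"

lemma ex1_derivation:
  assumes f: "clinear f"
  shows "\<exists>!D. is_derivation_extending f D"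
proof (rule ex_ex1I)
  note c = Vector_Spaces.linear_compose[unfolded o_def]
  define d where "d m = (\<Sum>v\<in>#m. f v *\<^sub>C sym_monom (m - {#v#}))" for m
  have d_add: "d (add_mset w m) = f w *\<^sub>C sym_monom m + emb w * d m" for w m
  proof -
    have "(\<Sum>v\<in>#m. f v *\<^sub>C sym_monom (add_mset w m - {#v#})) =
        (\<Sum>v\<in>#m. emb w * f v *\<^sub>C sym_monom (m - {#v#}))"
      by (rule arg_cong[where f = sum_mset], rule image_mset_cong)
        (simp add: diff_union_swap2 scaleC_mult_right)
    then show ?thesis by (simp add: d_def sum_mset_distrib_left)
  qed
  define D where "D x = free_lift d (rep_symalg x)" for x
  have D_abs: "D (abs_symalg p) = free_lift d p" for p
    unfolding D_def
  proof (rule free_lift_sym_rel)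
    note l = clinear_free_lift[of d]
    have s: "x * c *\<^sub>C y = c *\<^sub>C (x * y)" for c and x y :: "'a multiset \<Rightarrow>\<^sub>0 complex"
      by (simp add: scaleC_conv_mult algebra_simps)
    have k: "free_lift d (Poly_Mapping.single m 1 * indet v) = f v *\<^sub>C sym_monom m + emb v * d m" for m v
      by (simp add: mult_single free_lift_single d_add scaleC_one)
    show "free_lift d (Poly_Mapping.single m 1 * r) = 0" if "r \<in> sym_relators" for m r
      using that unfolding sym_relators_def
      by (auto simp: right_diff_distrib s clinear_diff[OF l] clinear_scale[OF l] k clinear_add[OF f]
          clinear_scale[OF f] clinear_add[OF clinear_emb] clinear_scale[OF clinear_emb]
          distrib_right scaleC_mult_left scaleC_add_left scaleC_add_right scaleC_complex_def
          simp del: mult_single)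
    show "sym_rel (rep_symalg (abs_symalg p)) p"
      using rep_abs_rsp_left[OF Quotient3_symalg] equivp_reflp[OF equivp_sym_rel] by blast
  qed
  have lin: "clinear D"
  proof (rule clinearI)
    fix x y :: "'a symalg" and c
    obtain p q where x: "x = abs_symalg p" and y: "y = abs_symalg q"
      using abs_symalg_exhaust by metis
    show "D (x + y) = D x + D y"
      unfolding x y plus_symalg.abs_eq D_abs by (rule clinear_add[OF clinear_free_lift])
    show "D (c *\<^sub>C x) = c *\<^sub>C D x"
      unfolding x scaleC_symalg.abs_eq D_abs by (rule clinear_scale[OF clinear_free_lift])
  qed
  have D_monom: "D (sym_monom m) = d m" for m
    by (simp add: abs_symalg_monom[symmetric] D_abs free_lift_single scaleC_one)
  have D1: "D 1 = 0" using D_monom[of "{#}"] by (simp add: d_def)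
  have De: "D (emb w) = f w *\<^sub>C 1" for w using D_monom[of "{#w#}"] by (simp add: d_def)
  have DE: "D (emb w * \<psi>) = f w *\<^sub>C \<psi> + emb w * D \<psi>" for w \<psi>
  proof (rule symalg_ext[of "\<lambda>\<psi>. D (emb w * \<psi>)"])
    show "D (emb w * sym_monom m) = f w *\<^sub>C sym_monom m + emb w * D (sym_monom m)" for m
      using D_monom[of "add_mset w m"] by (simp add: D_monom d_add)
  qed (intro c[OF clinear_mult_right lin] c[OF lin clinear_mult_right] clinear_add_fun
      clinear_scale_fun cvs.linear_ident)+
  have "D (\<phi> * \<psi>) = D \<phi> * \<psi> + \<phi> * D \<psi>" for \<phi> \<psi>
  proof (rule symalg_ext[of "\<lambda>\<phi>. D (\<phi> * \<psi>)"])
    show "D (sym_monom m * \<psi>) = D (sym_monom m) * \<psi> + sym_monom m * D \<psi>" for m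
      by (induction m)
        (simp_all add: D1 DE distrib_left distrib_right mult.assoc add.assoc scaleC_mult_left)
  qed (intro c[OF clinear_mult_left lin] c[OF lin clinear_mult_left] clinear_add_fun
      clinear_mult_left)+
  with lin D1 De show "\<exists>D. is_derivation_extending f D"
    unfolding is_derivation_extending_def by blast
next
  fix D D'
  assume D: "is_derivation_extending f D" and D': "is_derivation_extending f D'"
  have l: "clinear D" "clinear D'"
    using D D' by (auto simp: is_derivation_extending_def)
  show "D = D'"
  proof (rule ext, rule symalg_ext[OF l])
    show "D (sym_monom m) = D' (sym_monom m)" for m
    proof (induction m)
      case empty
      then show ?case using D D' by (simp add: is_derivation_extending_def)
    next
      case (add v m)
      then show ?case using D D' by (simp add: is_derivation_extending_def)
    qed
  qed
qed

lemma clinear_cinner: "clinear (cinner v)"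
  by (rule clinearI) (simp_all add: cinner_add_right cinner_scaleC_right scaleC_complex_def)

lemma annihilator: "is_derivation_extending (cinner v) (annihilator v)"
  unfolding annihilator_def by (rule theI'[OF ex1_derivation[OF clinear_cinner]])

lemma clinear_annihilator: "clinear (annihilator v)"
  using annihilator[of v] by (simp add: is_derivation_extending_def)

lemma clinear_creator: "clinear (creator v)"
  unfolding creator_def by (rule clinear_mult_right)


section \<open>The full antidual \<open>SV'\<close>\<close>

text \<open>All antilinear functionals, with no boundedness required.\<close>

typedef (overloaded) 'v symdual = "{\<Phi> :: 'v::complex_vector symalg \<Rightarrow> complex. antilinear \<Phi>}"
  morphisms dapply Abs_symdual
  by (rule exI[of _ "\<lambda>_. 0"]) (simp add: antilinear_def)

setup_lifting type_definition_symdual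

lemma antilinear_add: "antilinear f \<Longrightarrow> f (x + y) = f x + f y"
  and antilinear_scale: "antilinear f \<Longrightarrow> f (c *\<^sub>C x) = cnj c *\<^sub>C f x"
  by (simp_all add: antilinear_def)

lemma antilinear_comp_clinear: "antilinear f \<Longrightarrow> clinear h \<Longrightarrow> antilinear (\<lambda>x. f (h x))"
  by (simp add: antilinear_def clinear_add clinear_scale)

lemma antilinear_cnj: "clinear f \<Longrightarrow> antilinear (\<lambda>x. cnj (f x))"
  by (simp add: antilinear_def clinear_add clinear_scale scaleC_complex_def)

lemma clinear_cnj: "antilinear f \<Longrightarrow> clinear (\<lambda>x. cnj (f x))"
  by (rule clinearI) (simp_all add: antilinear_def scaleC_complex_def)

instantiation symdual :: (complex_vector) complex_vector
begin

lift_definition zero_symdual :: "'a symdual" is "\<lambda>_. 0"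
  by (simp add: antilinear_def)
lift_definition plus_symdual :: "'a symdual \<Rightarrow> 'a symdual \<Rightarrow> 'a symdual" is "\<lambda>\<Phi> \<Psi> \<theta>. \<Phi> \<theta> + \<Psi> \<theta>"
  by (simp add: antilinear_def scaleC_add_right)
lift_definition minus_symdual :: "'a symdual \<Rightarrow> 'a symdual \<Rightarrow> 'a symdual" is "\<lambda>\<Phi> \<Psi> \<theta>. \<Phi> \<theta> - \<Psi> \<theta>"
  by (simp add: antilinear_def cvs.scale_right_diff_distrib)
lift_definition uminus_symdual :: "'a symdual \<Rightarrow> 'a symdual" is "\<lambda>\<Phi> \<theta>. - \<Phi> \<theta>"
  by (simp add: antilinear_def)
lift_definition scaleC_symdual :: "complex \<Rightarrow> 'a symdual \<Rightarrow> 'a symdual" is "\<lambda>c \<Phi> \<theta>. c * \<Phi> \<theta>"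
  by (simp add: antilinear_def distrib_left scaleC_complex_def)

instance
  by standard (transfer; simp add: fun_eq_iff algebra_simps)+

end

text \<open>\<open>\<Delta>\<close> is the algebra homomorphism into the tensor product algebra (\<open>sym_lift_mult\<close>,
  \<open>sym_lift_one\<close>) with the prescribed values on \<open>V\<close>.\<close>

definition coproduct :: "'v::complex_vector symalg \<Rightarrow> ('v symalg, 'v symalg) tensor" where
  "coproduct = sym_lift (\<lambda>v. emb v \<otimes>\<^sub>t 1 + 1 \<otimes>\<^sub>t emb v)"

text \<open>The antilinear functional \<open>\<Phi> \<otimes> \<Psi>\<close>, characterised by \<open>tensor_fun_pure\<close>; the conjugations
  turn antilinear maps into linear ones and back.\<close>

definition tensor_fun :: "('a::complex_vector \<Rightarrow> complex) \<Rightarrow> ('b::complex_vector \<Rightarrow> complex) \<Rightarrow>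
    ('a, 'b) tensor \<Rightarrow> complex" where
  "tensor_fun \<Phi> \<Psi> t = cnj (tensor_lift (\<lambda>\<xi> \<eta>. cnj (\<Phi> \<xi> * \<Psi> \<eta>)) t)"

lemma cbilinear_cnj_mult:
  "antilinear \<Phi> \<Longrightarrow> antilinear \<Psi> \<Longrightarrow> cbilinear (\<lambda>\<xi> \<eta>. cnj (\<Phi> \<xi> * \<Psi> \<eta>))"
  for \<Phi> \<Psi> :: "_ \<Rightarrow> complex"
  unfolding cbilinear_def
  by (auto intro!: clinearI simp: antilinear_def scaleC_complex_def algebra_simps)

lemma tensor_fun_pure:
  assumes "antilinear \<Phi>" "antilinear \<Psi>"
  shows "tensor_fun \<Phi> \<Psi> (\<xi> \<otimes>\<^sub>t \<eta>) = \<Phi> \<xi> * \<Psi> \<eta>"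
  unfolding tensor_fun_def tensor_lift_pure[OF cbilinear_cnj_mult[OF assms]] by simp

lemma antilinear_tensor_fun:
  assumes "antilinear \<Phi>" "antilinear \<Psi>"
  shows "antilinear (tensor_fun \<Phi> \<Psi>)"
  unfolding tensor_fun_def by (rule antilinear_cnj[OF clinear_tensor_lift[OF cbilinear_cnj_mult[OF assms]]])

lemma clinear_coproduct_generators: "clinear (\<lambda>v. emb v \<otimes>\<^sub>t 1 + 1 \<otimes>\<^sub>t emb v)"
  by (rule clinearI) (simp_all add: clinear_add[OF clinear_emb] clinear_scale[OF clinear_emb]
      tensor_pure_add_left tensor_pure_add_right tensor_pure_scale_left tensor_pure_scale_right
      scaleC_add_right)

lemma clinear_coproduct: "clinear coproduct"
  unfolding coproduct_def by (rule clinear_sym_lift[OF clinear_coproduct_generators])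

text \<open>The unit of \<open>SV'\<close> is the counit of \<open>SV\<close>: the value at \<open>\<theta>\<close> is the conjugated component of
  \<open>\<theta>\<close> in degree \<open>0\<close>.\<close>

instantiation symdual :: (complex_vector) "{one, times}"
begin

lift_definition one_symdual :: "'a symdual" is "\<lambda>\<theta>. cnj (sym_lift (\<lambda>_. 0) \<theta>)"
  by (rule antilinear_cnj[OF clinear_sym_lift[OF cvs_pair.linear_zero]])

lift_definition times_symdual :: "'a symdual \<Rightarrow> 'a symdual \<Rightarrow> 'a symdual" is
  "\<lambda>\<Phi> \<Psi> \<theta>. tensor_fun \<Phi> \<Psi> (coproduct \<theta>)"
  by (rule antilinear_comp_clinear[OF antilinear_tensor_fun clinear_coproduct])

instance ..

end

instance symdual :: (complex_vector) power ..

lift_definition dual_creator :: "'v::complex_hilbert \<Rightarrow> 'v symdual \<Rightarrow> 'v symdual" is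
  "\<lambda>v \<Phi> \<psi>. \<Phi> (annihilator v \<psi>)"
  by (rule antilinear_comp_clinear[OF _ clinear_annihilator])

lift_definition dual_annihilator :: "'v::complex_hilbert \<Rightarrow> 'v symdual \<Rightarrow> 'v symdual" is
  "\<lambda>v \<Phi> \<psi>. \<Phi> (creator v \<psi>)"
  by (rule antilinear_comp_clinear[OF _ clinear_creator])

text \<open>The exponential series is evaluated pointwise; for an element that vanishes in degree \<open>0\<close>
  only finitely many terms are nonzero at each point.\<close>

definition dual_exp :: "'v::complex_vector symdual \<Rightarrow> 'v symdual" where
  "dual_exp \<Phi> = Abs_symdual (\<lambda>\<theta>. suminf (\<lambda>n. dapply (\<Phi> ^ n) \<theta> / fact n))"

lemma coproduct_monom:
  "coproduct (sym_monom m) \<in> cvs.span {sym_monom a \<otimes>\<^sub>t sym_monom b |a b. a + b = m}"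
proof (induction m)
  case empty
  have "coproduct 1 = (1 :: 'a symalg) \<otimes>\<^sub>t (1 :: 'a symalg)"
    by (simp add: coproduct_def sym_lift_one[OF clinear_coproduct_generators] one_tensor_def)
  then show ?case by (auto intro!: cvs.span_base)
next
  case (add v m)
  let ?S = "\<lambda>m :: 'a multiset. cvs.span {sym_monom a \<otimes>\<^sub>t sym_monom b |a b. a + b = m}"
  let ?g = "emb v \<otimes>\<^sub>t 1 + 1 \<otimes>\<^sub>t emb v"
  have "?g * t \<in> ?S (add_mset v m)" if "t \<in> ?S m" for t
    using that
  proof (induction rule: cvs.span_induct_alt)
    case base
    show ?case by (simp add: cvs.span_zero)
  next
    case (step c x y)
    then obtain a b where x: "x = sym_monom a \<otimes>\<^sub>t sym_monom b" and m: "m = a + b" by blast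
    have "sym_monom (add_mset v a) \<otimes>\<^sub>t sym_monom b \<in> ?S (add_mset v m)"
      "sym_monom a \<otimes>\<^sub>t sym_monom (add_mset v b) \<in> ?S (add_mset v m)"
      by (rule cvs.span_base, rule CollectI, intro exI conjI, rule refl, simp add: m)+
    then have "?g * x \<in> ?S (add_mset v m)"
      unfolding x by (simp add: distrib_right tensor_pure_mult cvs.span_add)
    then show ?case
      using step.IH by (simp add: distrib_left scaleC_mult_right cvs.span_add cvs.span_scale)
  qed
  from this[OF add.IH] show ?case
    by (simp add: coproduct_def sym_lift_mult[OF clinear_coproduct_generators]
        sym_lift_emb[OF clinear_coproduct_generators])
qed

lemma antilinear_dapply: "antilinear (dapply \<Phi>)"
  using dapply[of \<Phi>] by simp

lemma antilinear_eq_0_on_span: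
  assumes "antilinear f" "x \<in> cvs.span S" "\<And>x. x \<in> S \<Longrightarrow> f x = (0 :: complex)"
  shows "f x = 0"
  using cvs_pair.linear_eq_0_on_span[OF clinear_cnj[OF assms(1)] _ assms(2)] assms(3) by auto

lemma dapply_power_monom:
  assumes "dapply \<Phi> 1 = 0" "size m < n"
  shows "dapply (\<Phi> ^ n) (sym_monom m) = 0"
  using assms(2)
proof (induction n arbitrary: m)
  case 0
  then show ?case by simp
next
  case (Suc n)
  note t = antilinear_tensor_fun[OF antilinear_dapply[of \<Phi>] antilinear_dapply[of "\<Phi> ^ n"]]
  have "dapply (\<Phi> ^ Suc n) (sym_monom m) =
      tensor_fun (dapply \<Phi>) (dapply (\<Phi> ^ n)) (coproduct (sym_monom m))"
    by (simp add: times_symdual.rep_eq)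
  also have "\<dots> = 0"
  proof (rule antilinear_eq_0_on_span[OF t coproduct_monom])
    fix x assume "x \<in> {sym_monom a \<otimes>\<^sub>t sym_monom b |a b. a + b = m}"
    then obtain a b where x: "x = sym_monom a \<otimes>\<^sub>t sym_monom b" and m: "m = a + b" by blast
    show "tensor_fun (dapply \<Phi>) (dapply (\<Phi> ^ n)) x = 0"
    proof (cases "a = {#}")
      case True
      then show ?thesis
        by (simp add: x tensor_fun_pure antilinear_dapply assms(1))
    next
      case False
      then have "size b < n" using Suc.prems by (cases a) (auto simp: m)
      then show ?thesis
        by (simp add: x tensor_fun_pure antilinear_dapply Suc.IH)
    qed
  qed
  finally show ?case .
qed

lemma finite_dapply_power:
  assumes "dapply \<Phi> 1 = 0"
  shows "finite {n. dapply (\<Phi> ^ n) \<theta> \<noteq> 0}"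
proof -
  obtain p where p: "\<theta> = abs_symalg p" by (rule abs_symalg_exhaust)
  have "\<theta> = (\<Sum>m\<in>Poly_Mapping.keys p. Poly_Mapping.lookup p m *\<^sub>C sym_monom m)"
    by (subst p, subst poly_mapping_sum_single)
      (simp add: clinear_sum[OF clinear_abs_symalg] flip: abs_symalg_monom
        clinear_scale[OF clinear_abs_symalg], simp add: scaleC_single)
  moreover define N where "N = (\<Sum>m\<in>Poly_Mapping.keys p. size m)"
  ultimately have "\<theta> \<in> cvs.span (sym_monom ` Poly_Mapping.keys p)"
    by (metis (no_types, lifting) cvs.span_sum cvs.span_scale cvs.span_base imageI)
  moreover have "size m \<le> N" if "m \<in> Poly_Mapping.keys p" for m
    unfolding N_def by (rule member_le_sum[OF that]) auto
  ultimately have "dapply (\<Phi> ^ n) \<theta> = 0" if "N < n" for n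
    using that
    by (intro antilinear_eq_0_on_span[OF antilinear_dapply, of \<theta>])
      (auto intro!: dapply_power_monom[OF assms] intro: le_less_trans)
  then have "{n. dapply (\<Phi> ^ n) \<theta> \<noteq> 0} \<subseteq> {..N}" by (auto simp: not_less[symmetric])
  then show ?thesis by (rule finite_subset) simp
qed

lemma dapply_dual_exp:
  assumes "dapply \<Phi> 1 = 0"
  shows "dapply (dual_exp \<Phi>) \<theta> = suminf (\<lambda>n. dapply (\<Phi> ^ n) \<theta> / fact n)"
proof -
  have s: "summable (\<lambda>n. dapply (\<Phi> ^ n) \<theta> / fact n)" for \<theta>
    by (rule summable_finite[OF finite_dapply_power[OF assms, of \<theta>]]) auto
  have "antilinear (\<lambda>\<theta>. suminf (\<lambda>n. dapply (\<Phi> ^ n) \<theta> / fact n))"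
    unfolding antilinear_def
    by (auto simp: antilinear_add[OF antilinear_dapply] antilinear_scale[OF antilinear_dapply]
        scaleC_complex_def add_divide_distrib suminf_add[OF s s] suminf_mult[OF s]
        simp flip: times_divide_eq_right)
  then show ?thesis by (simp add: dual_exp_def Abs_symdual_inverse)
qed

definition field_op :: "'v::complex_hilbert \<Rightarrow> 'v symalg \<Rightarrow> 'v symalg" where
  "field_op v \<psi> = complex_of_real (1 / sqrt 2) *\<^sub>C (creator v \<psi> + annihilator v \<psi>)"

definition dual_field_op :: "'v::complex_hilbert \<Rightarrow> 'v symdual \<Rightarrow> 'v symdual" where
  "dual_field_op v \<Phi> = complex_of_real (1 / sqrt 2) *\<^sub>C (dual_creator v \<Phi> + dual_annihilator v \<Phi>)"


section \<open>The symplectic group and Gaussians\<close>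

definition symp_form :: "'v::complex_hilbert \<Rightarrow> 'v \<Rightarrow> real" where
  "symp_form x y = Im (cinner x y)"

definition Sp :: "('v::complex_hilbert \<Rightarrow> 'v) set" where
  "Sp = {g. linear g \<and> bij g \<and> (\<forall>x y. symp_form (g x) (g y) = symp_form x y)}"

definition cpx_J :: "'v::complex_hilbert \<Rightarrow> 'v" where
  "cpx_J v = \<i> *\<^sub>C v"

definition C_part :: "('v::complex_hilbert \<Rightarrow> 'v) \<Rightarrow> 'v \<Rightarrow> 'v" where
  "C_part g v = (1/2) *\<^sub>R (g v - cpx_J (g (cpx_J v)))"

definition A_part :: "('v::complex_hilbert \<Rightarrow> 'v) \<Rightarrow> 'v \<Rightarrow> 'v" where
  "A_part g v = (1/2) *\<^sub>R (g v + cpx_J (g (cpx_J v)))"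

definition Z_op :: "('v::complex_hilbert \<Rightarrow> 'v) \<Rightarrow> 'v \<Rightarrow> 'v" where
  "Z_op g v = - A_part g (inv (C_part g) v)"

definition is_quadratic :: "('v::complex_hilbert \<Rightarrow> 'v) \<Rightarrow> 'v symdual \<Rightarrow> bool" where
  "is_quadratic Z \<zeta> \<longleftrightarrow>
     (\<forall>d \<theta>. d \<noteq> 2 \<longrightarrow> \<theta> \<in> sym_grade d \<longrightarrow> dapply \<zeta> \<theta> = 0) \<and>
     (\<forall>x y. dapply \<zeta> (emb x * emb y) = cinner y (Z x))"

definition quadratic :: "('v::complex_hilbert \<Rightarrow> 'v) \<Rightarrow> 'v symdual" where
  "quadratic Z = (THE \<zeta>. is_quadratic Z \<zeta>)"

lemma ex1_quadratic:
  fixes Z :: "'v::complex_hilbert \<Rightarrow> 'v"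
  assumes Z: "antilinear Z" and sym: "\<And>x y. cinner y (Z x) = cinner x (Z y)"
  shows "\<exists>!\<zeta>. is_quadratic Z \<zeta>"
proof (rule ex_ex1I)
  define b where "b x y = cnj (cinner y (Z x))" for x y
  have b: "clinear (b w)" for w
    unfolding b_def
    by (rule clinearI)
      (simp_all add: sym[of _ w] antilinear_add[OF Z] antilinear_scale[OF Z] cinner_add_right
        cinner_scaleC_right scaleC_complex_def)
  have b_sym: "b x y = b y x" for x y by (simp add: b_def sym)
  define f where "f m = (if size m = 2 then (\<Sum>x\<in>#m. \<Sum>y\<in>#m - {#x#}. b x y) / 2 else 0)" for m
  have f2: "f {#x, y#} = b x y" for x y by (simp add: f_def b_sym[of y x])
  define L where "L x = free_lift f (rep_symalg x)" for x
  have L_abs: "L (abs_symalg p) = free_lift f p" for p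
    unfolding L_def
  proof (rule free_lift_sym_rel)
    note l = clinear_free_lift[of f]
    have s: "x * c *\<^sub>C y = c *\<^sub>C (x * y)" for c and x y :: "'v multiset \<Rightarrow>\<^sub>0 complex"
      by (simp add: scaleC_conv_mult algebra_simps)
    have k: "free_lift f (Poly_Mapping.single m 1 * indet v) = f (add_mset v m)" for m v
      by (simp add: mult_single free_lift_single scaleC_one)
    have lin: "clinear (\<lambda>v. f (add_mset v m))" for m
    proof (cases "size m = 1")
      case True
      then obtain w where "m = {#w#}" using size_1_singleton_mset by blast
      moreover have "f {#v, w#} = b w v" for v by (simp add: f2 b_sym)
      ultimately show ?thesis using b[of w] by simp
    next
      case False
      then have "f (add_mset v m) = 0" for v by (simp add: f_def)
      then show ?thesis by (simp add: cvs_pair.linear_zero)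
    qed
    show "free_lift f (Poly_Mapping.single m 1 * r) = 0" if "r \<in> sym_relators" for m r
      using that unfolding sym_relators_def
      by (auto simp: right_diff_distrib s clinear_diff[OF l] clinear_scale[OF l] k
          clinear_add[OF lin] clinear_scale[OF lin] simp del: mult_single)
    show "sym_rel (rep_symalg (abs_symalg p)) p"
      using rep_abs_rsp_left[OF Quotient3_symalg] equivp_reflp[OF equivp_sym_rel] by blast
  qed
  have lin: "clinear L"
  proof (rule clinearI)
    fix x y :: "'v symalg" and c
    obtain p q where x: "x = abs_symalg p" and y: "y = abs_symalg q"
      using abs_symalg_exhaust by metis
    show "L (x + y) = L x + L y"
      unfolding x y plus_symalg.abs_eq L_abs by (rule clinear_add[OF clinear_free_lift])
    show "L (c *\<^sub>C x) = c *\<^sub>C L x"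
      unfolding x scaleC_symalg.abs_eq L_abs by (rule clinear_scale[OF clinear_free_lift])
  qed
  have L_monom: "L (sym_monom m) = f m" for m
    by (simp add: abs_symalg_monom[symmetric] L_abs free_lift_single scaleC_one)
  have L_prod: "L (prod_list (map emb vs)) = f (mset vs)" for vs
    using L_monom[of "mset vs"] by (simp flip: mset_map add: prod_mset_prod_list)
  have ap: "dapply (Abs_symdual (\<lambda>x. cnj (L x))) \<theta> = cnj (L \<theta>)" for \<theta>
    by (simp add: Abs_symdual_inverse antilinear_cnj[OF lin])
  have "L \<theta> = 0" if "d \<noteq> 2" "\<theta> \<in> sym_grade d" for d \<theta>
    using that(2) unfolding sym_grade_def
    by (rule cvs_pair.linear_eq_0_on_span[OF lin, rotated])
      (use that(1) in \<open>auto simp: L_prod f_def\<close>)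
  moreover have "L (emb x * emb y) = b x y" for x y
    using L_monom[of "{#x, y#}"] by (simp add: f2)
  ultimately have "is_quadratic Z (Abs_symdual (\<lambda>x. cnj (L x)))"
    by (simp add: is_quadratic_def ap b_def)
  then show "\<exists>\<zeta>. is_quadratic Z \<zeta>" by blast
next
  fix \<zeta> \<zeta>'
  assume z: "is_quadratic Z \<zeta>" and z': "is_quadratic Z \<zeta>'"
  have l: "clinear (\<lambda>x. cnj (dapply \<zeta> x))" for \<zeta> :: "'v symdual"
    using dapply[of \<zeta>] by (intro clinear_cnj) simp
  have "cnj (dapply \<zeta> x) = cnj (dapply \<zeta>' x)" for x
  proof (rule symalg_ext[OF l l])
    fix m
    show "cnj (dapply \<zeta> (sym_monom m)) = cnj (dapply \<zeta>' (sym_monom m))"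
    proof (cases "size m = 2")
      case True
      then obtain x m' where m: "m = add_mset x m'" "size m' = 1"
        by (cases m) auto
      then obtain y where "m' = {#y#}" using size_1_singleton_mset by blast
      with m have "m = {#x, y#}" by simp
      then show ?thesis using z z' by (simp add: is_quadratic_def)
    next
      case False
      obtain vs where m: "m = mset vs" using ex_mset by metis
      have "sym_monom m = prod_list (map emb vs)"
        by (simp add: m prod_mset_prod_list flip: mset_map)
      then have "sym_monom m \<in> sym_grade (size m)"
        unfolding sym_grade_def by (intro cvs.span_base) (auto simp: m)
      then show ?thesis using z z' False by (simp add: is_quadratic_def)
    qed
  qed
  then show "\<zeta> = \<zeta>'" by (simp add: dapply_inject[symmetric] fun_eq_iff)
qed

text \<open>\<open>quadratic (Z_op g)\<close> is the functional \<open>\<zeta>\<^sub>g\<close>, and \<open>gauss g\<close> is \<open>e\<close> to the \<open>Z\<^sub>g\<close>.\<close>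

definition gauss :: "('v::complex_hilbert \<Rightarrow> 'v) \<Rightarrow> 'v symdual" where
  "gauss g = dual_exp (quadratic (Z_op g))"


section \<open>Fock implementers\<close>

text \<open>The operator \<open>c\<^sub>g(v) = c(C\<^sub>g v) + a(A\<^sub>g v)\<close> on \<open>SV'\<close>.\<close>

definition transformed_creator :: "('v::complex_hilbert \<Rightarrow> 'v) \<Rightarrow> 'v \<Rightarrow> 'v symdual \<Rightarrow> 'v symdual" where
  "transformed_creator g v \<Phi> = dual_creator (C_part g v) \<Phi> + dual_annihilator (A_part g v) \<Phi>"

definition fock_implementer ::
  "('v::complex_hilbert \<Rightarrow> 'v) \<Rightarrow> ('v symalg \<Rightarrow> 'v symdual) \<Rightarrow> bool" where
  "fock_implementer g U \<longleftrightarrow>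
     clinear U \<and> U \<noteq> (\<lambda>_. 0) \<and> (\<forall>v \<psi>. U (field_op v \<psi>) = dual_field_op (g v) (U \<psi>))"

end

theory Submission
  imports Defs
begin

text \<open>
  Everything rests on the operators \<open>c\<^sub>g(v)\<close> and \<open>a\<^sub>g(v)\<close>. For symplectic \<open>g\<close> they satisfy the same
  commutation relations as creators and annihilators (\<open>transformed_creator_commute\<close>,
  \<open>transformed_ccr\<close>), and \<open>\<pi>(gv)\<close> is \<open>c\<^sub>g(v) + a\<^sub>g(v)\<close> up to the factor \<open>1/\<surd>2\<close>. Comparing \<open>v\<close> with
  \<open>\<i> v\<close> shows that a linear map intertwines the field operators if and only if it carries
  \<open>c(v)\<close> to \<open>c\<^sub>g(v)\<close> and \<open>a(v)\<close> to \<open>a\<^sub>g(v)\<close> (\<open>implements_iff_intertwines\<close>).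

  Hence an implementer sends the vacuum \<open>1\<close> to some \<open>\<Phi>\<close> with \<open>a\<^sub>g(v) \<Phi> = 0\<close> for all \<open>v\<close>, and is
  determined by \<open>\<Phi>\<close>, because monomials are products of creators applied to \<open>1\<close>. As \<open>C\<^sub>g\<close> is onto
  (\<open>bij_C_part\<close>), the condition on \<open>\<Phi>\<close> reads \<open>a(x) \<Phi> = c(Z\<^sub>g x) \<Phi>\<close> for all \<open>x\<close>. Since \<open>a(x)\<close> acts on \<open>SV'\<close> as
  a derivation and \<open>c(w)\<close> as multiplication by a linear functional, this is the differential
  equation of the Gaussian: \<open>gauss g\<close> solves it (\<open>dual_annihilator_exp\<close>), and induction on the degree
  shows that a solution is determined by its value at \<open>1\<close> (\<open>symdual_eq_0I\<close>).

  Conversely, since the \<open>c\<^sub>g(v)\<close> commute, their products applied to \<open>gauss g\<close> define a linear map on \<open>SV\<close>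
  (\<open>ex_clinear_of_commuting_family\<close>); it intertwines creators by construction and annihilators by
  the vacuum condition and the commutation relations.

  The only analysis is the surjectivity of \<open>C\<^sub>g\<close>. Its formal adjoint is the complex-linear part
  of \<open>inv g\<close>, both are bounded below, and the minimisation argument of \<open>surj_of_adjoint\<close> applies.
\<close>

section \<open>Inner products\<close>

lemma cinner_add_left: "cinner (x + y) z = cinner x z + cinner y z"
  by (metis cinner_add_right cinner_commute complex_cnj_add)

lemma cinner_scaleC_left: "cinner (c *\<^sub>C x) y = cnj c * cinner x y"
  by (metis cinner_scaleC_right cinner_commute complex_cnj_mult)

lemma cinner_minus_right: "cinner x (- y) = - cinner x y"
  using cinner_scaleC_right[of x "-1" y] by (simp add: cvs.scale_minus_left)

lemma cinner_minus_left: "cinner (- x) y = - cinner x y"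
  using cinner_scaleC_left[of "-1" x y] by (simp add: cvs.scale_minus_left)

lemma cinner_diff_right: "cinner x (y - z) = cinner x y - cinner x z"
  using cinner_add_right[of x y "- z"] by (simp add: cinner_minus_right)

lemma cinner_diff_left: "cinner (x - y) z = cinner x z - cinner y z"
  using cinner_add_left[of x "- y" z] by (simp add: cinner_minus_left)

lemmas cinner_simps = cinner_add_left cinner_add_right cinner_diff_left cinner_diff_right
  cinner_minus_left cinner_minus_right cinner_scaleC_left cinner_scaleC_right

lemma Re_cinner_commute: "Re (cinner y x) = Re (cinner x y)"
  by (subst cinner_commute) simp

lemma norm_add_sq: "(norm (x + y))\<^sup>2 = (norm x)\<^sup>2 + 2 * Re (cinner x y) + (norm y)\<^sup>2"
  for x :: "'v::complex_hilbert"
proof -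
  have "Re (cinner (x + y) (x + y)) = Re (cinner x x) + 2 * Re (cinner x y) + Re (cinner y y)"
    by (simp add: cinner_simps Re_cinner_commute[of y x])
  then show ?thesis unfolding cinner_self by (simp add: algebra_simps)
qed

lemma parallelogram: "(norm (x - y))\<^sup>2 = 2 * (norm x)\<^sup>2 + 2 * (norm y)\<^sup>2 - (norm (x + y))\<^sup>2"
  for x :: "'v::complex_hilbert"
  using norm_add_sq[of x y] norm_add_sq[of x "- y"] by (simp add: cinner_simps)

text \<open>Polarisation makes the inner product continuous without an appeal to the Cauchy-Schwarz
  inequality.\<close>

lemma Re_cinner_polar: "Re (cinner x y) = ((norm (x + y))\<^sup>2 - (norm x)\<^sup>2 - (norm y)\<^sup>2) / 2"
  using norm_add_sq[of x y] by simp

lemma tendsto_Re_cinner: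
  "(X \<longlonglongrightarrow> x) \<Longrightarrow> (\<lambda>n. Re (cinner (X n) y)) \<longlonglongrightarrow> Re (cinner x y)"
  unfolding Re_cinner_polar by (intro tendsto_intros) auto

lemma cinner_ext_Re:
  assumes "\<And>w. Re (cinner x w) = Re (cinner y w)" shows "x = y"
proof -
  have "Re (cinner (x - y) (x - y)) = 0" by (simp add: cinner_diff_left assms)
  then show ?thesis unfolding cinner_self by simp
qed

text \<open>A closed range argument in which a formal adjoint takes the place of boundedness. Since \<open>T\<close> is bounded below,
  a sequence \<open>X\<close> for which \<open>T X\<^sub>n\<close> minimises the distance to \<open>y\<close> is Cauchy, by the parallelogram law.
  The limit of \<open>T X\<^sub>n\<close> is \<open>T x\<close>, since by the adjoint it converges weakly to \<open>T x\<close> for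
  \<open>x = lim X\<^sub>n\<close>, so the minimum is attained at \<open>x\<close>, and the residual \<open>r = T x - y\<close>, being orthogonal
  to the range, satisfies \<open>S r = 0\<close>.\<close>

lemma surj_of_adjoint:
  fixes T :: "'v::complex_hilbert \<Rightarrow> 'w::complex_hilbert"
  assumes T: "clinear T"
    and adj: "\<And>x y. cinner (T x) y = cinner x (S y)"
    and below: "\<And>x. norm x \<le> norm (T x)"
    and inj: "\<And>y. S y = 0 \<Longrightarrow> y = 0"
  shows "surj T"
  unfolding surj_def
proof
  fix y
  note [simp] = clinear_add[OF T] clinear_diff[OF T] clinear_scale[OF T]
  have TR: "T (r *\<^sub>R x) = r *\<^sub>R T x" for r x by (simp add: scaleR_scaleC)
  define f where "f x = (norm (T x - y))\<^sup>2" for x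
  define d where "d = Inf (range f)"
  have bdd: "bdd_below (range f)" by (rule bdd_belowI[of _ 0]) (auto simp: f_def)
  have low: "d \<le> f x" for x unfolding d_def by (rule cInf_lower[OF _ bdd]) simp
  have "\<exists>x. f x < d + inverse (Suc n)" for n
    using cInf_lessD[of "range f" "d + inverse (Suc n)"] by (auto simp flip: d_def)
  then obtain X where X: "f (X n) < d + inverse (Suc n)" for n by metis
  have close: "(norm (T (X n) - T (X m)))\<^sup>2 \<le> 2 * inverse (Suc n) + 2 * inverse (Suc m)" for n m
  proof -
    \<comment> \<open>the midpoint of \<open>X n\<close> and \<open>X m\<close> cannot come closer to \<open>y\<close> than the infimum\<close>
    define u where "u = (1/2) *\<^sub>R (X n + X m)"
    have "(T (X n) - y) + (T (X m) - y) = 2 *\<^sub>R (T u - y)"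
      unfolding u_def TR by (simp add: algebra_simps scaleR_2)
    then have "(norm ((T (X n) - y) + (T (X m) - y)))\<^sup>2 = 4 * f u"
      by (simp add: f_def power_mult_distrib)
    then show ?thesis
      using parallelogram[of "T (X n) - y" "T (X m) - y"] low[of u] X[of n] X[of m]
      by (simp add: f_def)
  qed
  have "Cauchy (\<lambda>n. T (X n))"
  proof (rule metric_CauchyI)
    fix e :: real assume e: "e > 0"
    then have "e\<^sup>2 / 4 > 0" by simp
    then obtain N where N: "inverse (Suc N) < e\<^sup>2 / 4" using reals_Archimedean by blast
    have "dist (T (X m)) (T (X n)) < e" if "m \<ge> N" "n \<ge> N" for m n
    proof -
      have "inverse (real (Suc m)) \<le> inverse (Suc N)" "inverse (real (Suc n)) \<le> inverse (Suc N)"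
        using that by (auto simp: divide_simps)
      then have "(norm (T (X m) - T (X n)))\<^sup>2 < e\<^sup>2" using close[of m n] N by linarith
      then show ?thesis using e by (simp add: dist_norm power2_less_imp_less)
    qed
    then show "\<exists>M. \<forall>m\<ge>M. \<forall>n\<ge>M. dist (T (X m)) (T (X n)) < e" by blast
  qed
  moreover have "dist (X m) (X n) \<le> dist (T (X m)) (T (X n))" for m n
    using below[of "X m - X n"] by (simp add: dist_norm)
  ultimately have "Cauchy X"
    unfolding Cauchy_def by (meson le_less_trans)
  then obtain x where x: "X \<longlonglongrightarrow> x" unfolding Cauchy_convergent_iff convergent_def by blast
  obtain z where z: "(\<lambda>n. T (X n)) \<longlonglongrightarrow> z"
    using \<open>Cauchy (\<lambda>n. T (X n))\<close> unfolding Cauchy_convergent_iff convergent_def by blast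
  have "T x = z"
  proof (rule cinner_ext_Re)
    fix w
    show "Re (cinner (T x) w) = Re (cinner z w)"
      using LIMSEQ_unique[OF tendsto_Re_cinner[OF z] tendsto_Re_cinner[OF x, of "S w", folded adj]]
      by simp
  qed
  have "(\<lambda>n. f (X n)) \<longlonglongrightarrow> f x"
    unfolding f_def \<open>T x = z\<close> by (intro tendsto_intros z)
  moreover have "(\<lambda>n. d + inverse (Suc n)) \<longlonglongrightarrow> d + 0"
    by (intro tendsto_intros LIMSEQ_inverse_real_of_nat)
  ultimately have "f x \<le> d + 0"
    using X by (intro LIMSEQ_le) (auto intro: less_imp_le)
  then have min: "f x \<le> f u" for u using low[of u] by simp
  define r where "r = T x - y"
  \<comment> \<open>the first variation of \<open>f\<close> at its minimum, in the direction \<open>- S r\<close>\<close>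
  have "2 * (norm (S r))\<^sup>2 \<le> e * (norm (T (S r)))\<^sup>2" if "e > 0" for e
  proof -
    have "Re (cinner r (T (S r))) = (norm (S r))\<^sup>2"
      unfolding Re_cinner_commute[of r] adj cinner_self by simp
    then have c: "Re (cinner r (- (e *\<^sub>R T (S r)))) = - e * (norm (S r))\<^sup>2"
      by (simp add: cinner_simps scaleR_scaleC)
    have "T (x - e *\<^sub>R S r) - y = r + - (e *\<^sub>R T (S r))" by (simp add: r_def TR)
    then have "f (x - e *\<^sub>R S r) = f x + 2 * (- e * (norm (S r))\<^sup>2) + e\<^sup>2 * (norm (T (S r)))\<^sup>2"
      unfolding f_def by (simp only: norm_add_sq c) (simp add: r_def power_mult_distrib)
    then have "0 \<le> e * (e * (norm (T (S r)))\<^sup>2 - 2 * (norm (S r))\<^sup>2)"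
      using min[of "x - e *\<^sub>R S r"] by (simp add: algebra_simps power2_eq_square)
    then show ?thesis using that by (simp add: zero_le_mult_iff)
  qed
  then have "2 * (norm (S r))\<^sup>2 \<le> inverse (Suc n) * (norm (T (S r)))\<^sup>2" for n by simp
  moreover have "(\<lambda>n. inverse (Suc n) * (norm (T (S r)))\<^sup>2) \<longlonglongrightarrow> 0 * (norm (T (S r)))\<^sup>2"
    by (intro tendsto_intros LIMSEQ_inverse_real_of_nat)
  ultimately have "2 * (norm (S r))\<^sup>2 \<le> 0 * (norm (T (S r)))\<^sup>2"
    by (intro LIMSEQ_le_const) auto
  then have "S r = 0" by simp
  then have "T x = y" using inj[of r] by (simp add: r_def)
  then show "\<exists>x. y = T x" by blast
qed

section \<open>Complex-linear and antilinear parts of a symplectic map\<close>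

lemma C_plus_A: "C_part g v + A_part g v = g v"
  by (simp add: C_part_def A_part_def algebra_simps flip: scaleR_2)

text \<open>Reduces complex-linearity and antilinearity to real-linearity and the behaviour under \<open>J\<close>.\<close>

lemma scaleC_split: "c *\<^sub>C v = Re c *\<^sub>R v + Im c *\<^sub>R cpx_J v" for v :: "'v::complex_hilbert"
proof -
  have "Re c *\<^sub>R v + Im c *\<^sub>R cpx_J v = (complex_of_real (Re c) + Im c * \<i>) *\<^sub>C v"
    by (simp add: scaleR_scaleC cpx_J_def scaleC_scaleC scaleC_add_left)
  also have "complex_of_real (Re c) + Im c * \<i> = c" by (simp add: complex_eq_iff)
  finally show ?thesis by simp
qed

lemma cpx_J_simps:
  "cpx_J (x + y) = cpx_J x + cpx_J y" "cpx_J (r *\<^sub>R x) = r *\<^sub>R cpx_J x" "cpx_J (cpx_J x) = - x"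
  "cpx_J (- x) = - cpx_J x"  "cpx_J (x - y) = cpx_J x - cpx_J y"
  by (simp_all add: cpx_J_def scaleC_add_right scaleR_scaleC scaleC_scaleC mult.commute
     cvs.scale_minus_left cvs.scale_minus_right cvs.scale_right_diff_distrib)

lemma clinear_C_part:
  assumes g: "linear g" shows "clinear (C_part g)"
proof (rule clinearI)
  note [simp] = linear_add[OF g] linear_scale[OF g] linear_diff[OF g] linear_neg[OF g]
  fix x y and c
  show "C_part g (x + y) = C_part g x + C_part g y"
    by (simp add: C_part_def cpx_J_simps algebra_simps)
  show "C_part g (c *\<^sub>C x) = c *\<^sub>C C_part g x"
    by (simp add: C_part_def scaleC_split cpx_J_simps algebra_simps)
qed

lemma antilinear_A_part:
  assumes g: "linear g" shows "antilinear (A_part g)"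
proof -
  note [simp] = linear_add[OF g] linear_scale[OF g] linear_diff[OF g] linear_neg[OF g]
  have "A_part g (x + y) = A_part g x + A_part g y" for x y
    by (simp add: A_part_def cpx_J_simps algebra_simps)
  moreover have "A_part g (c *\<^sub>C x) = cnj c *\<^sub>C A_part g x" for c x
    by (simp add: A_part_def scaleC_split cpx_J_simps algebra_simps)
  ultimately show ?thesis by (simp add: antilinear_def)
qed

text \<open>The defining identity of a symplectic map says that the imaginary parts of
  \<open>B + E\<close> and of the inner product agree, where \<open>B\<close> is the left side of
  the first relation, a sesquilinear form, and \<open>E\<close> is the difference of the sides of the second one,
  antilinear in both variables. Replacing \<open>x\<close> and \<open>y\<close> by their multiples by \<open>\<i>\<close> separates the two types, so \<open>B\<close> is the inner
  product and \<open>E\<close> vanishes.\<close>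

lemma symplectic_relations:
  assumes g: "g \<in> Sp"
  shows "cinner (C_part g x) (C_part g y) - cinner (A_part g y) (A_part g x) = cinner x y"
    and "cinner (C_part g x) (A_part g y) = cinner (C_part g y) (A_part g x)"
proof -
  have lin: "linear g" using g by (simp add: Sp_def)
  note [simp] = clinear_scale[OF clinear_C_part[OF lin]] antilinear_scale[OF antilinear_A_part[OF lin]]
  let ?B = "\<lambda>x y. cinner (C_part g x) (C_part g y) - cinner (A_part g y) (A_part g x)"
  let ?E = "\<lambda>x y. cinner (C_part g x) (A_part g y) - cinner (C_part g y) (A_part g x)"
  have Im: "Im (?B x y + ?E x y) = Im (cinner x y)" for x y
  proof -
    have "Im (cinner (g x) (g y)) = Im (cinner x y)" using g by (simp add: Sp_def symp_form_def)
    then show ?thesis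
      unfolding C_plus_A[of g x, symmetric] C_plus_A[of g y, symmetric]
      by (simp add: cinner_simps cinner_commute[of "A_part g x" "C_part g y"]
          cinner_commute[of "A_part g x" "A_part g y"])
  qed
  note eqs = Im[of x y] Im[of x "\<i> *\<^sub>C y"] Im[of "\<i> *\<^sub>C x" y] Im[of "\<i> *\<^sub>C x" "\<i> *\<^sub>C y"]
  show "?B x y = cinner x y"
    by (rule complex_eqI) (use eqs in \<open>simp_all add: cinner_simps\<close>)
  have "?E x y = 0"
    by (rule complex_eqI) (use eqs in \<open>simp_all add: cinner_simps\<close>)
  then show "cinner (C_part g x) (A_part g y) = cinner (C_part g y) (A_part g x)" by simp
qed

lemma norm_le_C_part: "g \<in> Sp \<Longrightarrow> norm x \<le> norm (C_part g x)"
proof -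
  assume "g \<in> Sp"
  from arg_cong[OF symplectic_relations(1)[OF this, of x x], of Re]
  have "(norm (C_part g x))\<^sup>2 - (norm (A_part g x))\<^sup>2 = (norm x)\<^sup>2"
    unfolding cinner_self by simp
  then have "(norm x)\<^sup>2 \<le> (norm (C_part g x))\<^sup>2"
    using zero_le_power2[of "norm (A_part g x)"] by linarith
  then show ?thesis by (rule power2_le_imp_le) simp
qed

lemma inv_Sp:
  assumes g: "g \<in> Sp" shows "inv g \<in> Sp"
proof -
  have lin: "linear g" and bij: "bij g"
    and form: "symp_form (g x) (g y) = symp_form x y" for x y
    using g by (simp_all add: Sp_def)
  have gh [simp]: "g (inv g y) = y" for y by (simp add: bij bij_is_surj surj_f_inv_f)
  have hg: "inv g (g x) = x" for x by (simp add: bij bij_is_inj inv_f_f)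
  have "linear (inv g)"
  proof (rule linearI)
    show "inv g (x + y) = inv g x + inv g y" for x y
      using hg[of "inv g x + inv g y"] by (simp add: linear_add[OF lin])
    show "inv g (r *\<^sub>R x) = r *\<^sub>R inv g x" for r x
      using hg[of "r *\<^sub>R inv g x"] by (simp add: linear_scale[OF lin])
  qed
  moreover have "symp_form (inv g x) (inv g y) = symp_form x y" for x y
    using form[of "inv g x" "inv g y"] by simp
  ultimately show ?thesis by (simp add: Sp_def bij bij_imp_bij_inv)
qed

text \<open>The form \<open>\<Omega>\<close> turns \<open>g\<close> into \<open>inv g\<close> when it is moved across; the sesquilinear part of this
  identity is isolated by the same substitution of multiples by \<open>\<i>\<close>.\<close>

lemma C_part_adjoint:
  assumes g: "g \<in> Sp"
  shows "cinner (C_part g x) y = cinner x (C_part (inv g) y)"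
proof -
  let ?h = "inv g"
  have lin: "linear g" "linear ?h" using g inv_Sp[OF g] by (simp_all add: Sp_def)
  note [simp] = clinear_scale[OF clinear_C_part] antilinear_scale[OF antilinear_A_part] lin
  have gh: "g (?h y) = y" for y using g by (simp add: Sp_def bij_is_surj surj_f_inv_f)
  have Im: "Im (cinner (C_part g x) y - cinner x (C_part ?h y)
      + (cinner (A_part g x) y + cinner (A_part ?h y) x)) = 0" for x y
  proof -
    have "Im (cinner (g x) (g (?h y))) = Im (cinner x (?h y))" using g by (simp add: Sp_def symp_form_def)
    then show ?thesis
      unfolding gh unfolding C_plus_A[of g x, symmetric] C_plus_A[of ?h y, symmetric]
      by (simp add: cinner_simps cinner_commute[of "A_part ?h y" x])
  qed
  show ?thesis
    by (rule complex_eqI)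
     (use Im[of x y] Im[of x "\<i> *\<^sub>C y"] Im[of "\<i> *\<^sub>C x" y] Im[of "\<i> *\<^sub>C x" "\<i> *\<^sub>C y"]
      in \<open>simp_all add: cinner_simps\<close>)
qed

text \<open>Both \<open>C\<^sub>g\<close> and its formal adjoint are bounded below by \<open>1\<close>.\<close>

lemma bij_C_part:
  assumes g: "g \<in> Sp" shows "bij (C_part g)"
proof (rule bijI)
  have lin: "clinear (C_part g)" using g by (simp add: Sp_def clinear_C_part)
  show "inj (C_part g)"
  proof (rule injI)
    fix x y assume "C_part g x = C_part g y"
    then show "x = y" using norm_le_C_part[OF g, of "x - y"] by (simp add: clinear_diff[OF lin])
  qed
  show "surj (C_part g)"
  proof (rule surj_of_adjoint[OF lin C_part_adjoint[OF g] norm_le_C_part[OF g]])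
    show "y = 0" if "C_part (inv g) y = 0" for y
      using norm_le_C_part[OF inv_Sp[OF g], of y] that by simp
  qed
qed

lemma Z_op_C_part: "g \<in> Sp \<Longrightarrow> Z_op g (C_part g x) = - A_part g x"
  by (simp add: Z_op_def inv_f_f[OF bij_is_inj[OF bij_C_part]])

lemma antilinear_Z_op:
  assumes g: "g \<in> Sp" shows "antilinear (Z_op g)"
proof -
  have lin: "linear g" using g by (simp add: Sp_def)
  note [simp] = Z_op_C_part[OF g] antilinear_add[OF antilinear_A_part[OF lin]]
    antilinear_scale[OF antilinear_A_part[OF lin]]
  have "Z_op g (C_part g x + C_part g y) = Z_op g (C_part g x) + Z_op g (C_part g y)"
    "Z_op g (c *\<^sub>C C_part g x) = cnj c *\<^sub>C Z_op g (C_part g x)" for x y c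
    unfolding clinear_add[OF clinear_C_part[OF lin], symmetric]
       clinear_scale[OF clinear_C_part[OF lin], symmetric]
    by (simp_all add: cvs.scale_minus_right)
  then have "Z_op g (x + y) = Z_op g x + Z_op g y" "Z_op g (c *\<^sub>C x) = cnj c *\<^sub>C Z_op g x" for x y c
    using surj_f_inv_f[OF bij_is_surj[OF bij_C_part[OF g]]] by metis+
  then show ?thesis by (simp add: antilinear_def)
qed

lemma Z_op_symmetric:
  assumes g: "g \<in> Sp" shows "cinner y (Z_op g x) = cinner x (Z_op g y)"
proof -
  obtain u v where "x = C_part g u" "y = C_part g v"
    using bij_is_surj[OF bij_C_part[OF g]] surjD by meson
  then show ?thesis
    using symplectic_relations(2)[OF g, of v u] by (simp add: Z_op_C_part[OF g] cinner_minus_right)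
qed

section \<open>Linear maps out of the symmetric algebra\<close>

text \<open>The universal property of the symmetric algebra as a cyclic module: commuting operators that
  depend linearly on a vector make \<open>'a\<close> a module over \<open>SV\<close>, and \<open>U\<close> is the orbit map of \<open>e\<close>. The
  commutation makes the value on a multiset of vectors independent of their order, and linearity in the
  vector makes the map descend to the quotient.\<close>

lemma ex_clinear_of_commuting_family:
  fixes T :: "'v::complex_vector \<Rightarrow> 'a::complex_vector \<Rightarrow> 'a"
  assumes op: "\<And>v. clinear (T v)" and lin: "\<And>x. clinear (\<lambda>v. T v x)"
    and comm: "\<And>v w x. T v (T w x) = T w (T v x)"
  shows "\<exists>U. clinear U \<and> U 1 = e \<and> (\<forall>v \<psi>. U (emb v * \<psi>) = T v (U \<psi>))"
proof -
  interpret comp_fun_commute T by unfold_locales (simp add: fun_eq_iff comm)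
  define f where "f = fold_mset T e"
  have f0: "f {#} = e" and f_add: "f (add_mset v m) = T v (f m)" for v m
    by (simp_all add: f_def)
  define U where "U x = free_lift f (rep_symalg x)" for x
  have U_abs: "U (abs_symalg p) = free_lift f p" for p
    unfolding U_def
  proof (rule free_lift_sym_rel)
    note l = clinear_free_lift[of f]
    have s: "x * c *\<^sub>C y = c *\<^sub>C (x * y)" for c and x y :: "'v multiset \<Rightarrow>\<^sub>0 complex"
      by (simp add: scaleC_conv_mult algebra_simps)
    have k: "free_lift f (Poly_Mapping.single m 1 * indet v) = T v (f m)" for m v
      by (simp add: mult_single free_lift_single f_add scaleC_one)
    show "free_lift f (Poly_Mapping.single m 1 * r) = 0" if "r \<in> sym_relators" for m r
      using that unfolding sym_relators_def
      by (auto simp: right_diff_distrib s clinear_diff[OF l] clinear_scale[OF l] k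
          clinear_add[OF lin] clinear_scale[OF lin] simp del: mult_single)
    show "sym_rel (rep_symalg (abs_symalg p)) p"
      using rep_abs_rsp_left[OF Quotient3_symalg] equivp_reflp[OF equivp_sym_rel] by blast
  qed
  have clin: "clinear U"
  proof (rule clinearI)
    fix x y :: "'v symalg" and c
    obtain p q where x: "x = abs_symalg p" and y: "y = abs_symalg q"
      using abs_symalg_exhaust by metis
    show "U (x + y) = U x + U y"
      unfolding x y plus_symalg.abs_eq U_abs by (rule clinear_add[OF clinear_free_lift])
    show "U (c *\<^sub>C x) = c *\<^sub>C U x"
      unfolding x scaleC_symalg.abs_eq U_abs by (rule clinear_scale[OF clinear_free_lift])
  qed
  have U_monom: "U (sym_monom m) = f m" for m
    by (simp add: abs_symalg_monom[symmetric] U_abs free_lift_single scaleC_one)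
  note c = Vector_Spaces.linear_compose[unfolded o_def]
  have "U (emb v * \<psi>) = T v (U \<psi>)" for v \<psi>
  proof (rule symalg_ext[of "\<lambda>\<psi>. U (emb v * \<psi>)"])
    show "U (emb v * sym_monom m) = T v (U (sym_monom m))" for m
      using U_monom[of "add_mset v m"] by (simp add: U_monom f_add)
  qed (intro c[OF clinear_mult_right clin] c[OF clin op])+
  moreover have "U 1 = e" using U_monom[of "{#}"] by (simp add: f0)
  ultimately show ?thesis using clin by blast
qed

lemma symalg_eq_of_emb_mult:
  fixes U W :: "'v::complex_vector symalg \<Rightarrow> 'a::complex_vector"
  assumes "clinear U" "clinear W" "U 1 = W 1"
    and "\<And>v \<psi>. U (emb v * \<psi>) = T v (U \<psi>)" "\<And>v \<psi>. W (emb v * \<psi>) = T v (W \<psi>)"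
  shows "U = W"
proof (rule ext, rule symalg_ext[OF assms(1,2)])
  show "U (sym_monom m) = W (sym_monom m)" for m by (induction m) (simp_all add: assms)
qed

section \<open>Creators and annihilators on the symmetric algebra and its antidual\<close>

lemma annihilator_1 [simp]: "annihilator v 1 = 0"
  and annihilator_emb_mult:
    "annihilator v (emb w * \<psi>) = cinner v w *\<^sub>C \<psi> + emb w * annihilator v \<psi>"
  using annihilator[of v] by (simp_all add: is_derivation_extending_def scaleC_mult_left)

lemmas annihilator_linear_simps =
  clinear_add[OF clinear_annihilator] clinear_scale[OF clinear_annihilator]
  clinear_0[OF clinear_annihilator]

lemma annihilator_commute: "annihilator v (annihilator w \<psi>) = annihilator w (annihilator v \<psi>)"
proof (rule symalg_ext[of "\<lambda>\<psi>. annihilator v (annihilator w \<psi>)"])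
  show "annihilator v (annihilator w (sym_monom m)) = annihilator w (annihilator v (sym_monom m))" for m
    by (induction m) (simp_all add: annihilator_emb_mult annihilator_linear_simps ac_simps)
qed (intro Vector_Spaces.linear_compose[unfolded o_def, OF clinear_annihilator clinear_annihilator])+

lemma annihilator_add: "annihilator (v + w) \<psi> = annihilator v \<psi> + annihilator w \<psi>"
proof (rule symalg_ext[of "annihilator (v + w)"])
  show "annihilator (v + w) (sym_monom m) = annihilator v (sym_monom m) + annihilator w (sym_monom m)" for m
    by (induction m) (simp_all add: annihilator_emb_mult cinner_add_left scaleC_add_left distrib_left)
qed (intro clinear_annihilator clinear_add_fun)+

lemma annihilator_scale: "annihilator (c *\<^sub>C v) \<psi> = cnj c *\<^sub>C annihilator v \<psi>"
proof (rule symalg_ext[of "annihilator (c *\<^sub>C v)"])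
  show "annihilator (c *\<^sub>C v) (sym_monom m) = cnj c *\<^sub>C annihilator v (sym_monom m)" for m
    by (induction m)
      (simp_all add: annihilator_emb_mult cinner_scaleC_left scaleC_add_right scaleC_scaleC scaleC_mult_right)
qed (intro clinear_annihilator clinear_scale_fun)+

lemma dapply_dual_creator: "dapply (dual_creator v \<Phi>) \<theta> = dapply \<Phi> (annihilator v \<theta>)"
  and dapply_dual_annihilator: "dapply (dual_annihilator v \<Phi>) \<theta> = dapply \<Phi> (emb v * \<theta>)"
  by (simp_all add: dual_creator.rep_eq dual_annihilator.rep_eq creator_def)

lemma dapply_linear_simps:
  "dapply \<Phi> (\<theta> + \<eta>) = dapply \<Phi> \<theta> + dapply \<Phi> \<eta>"
  "dapply \<Phi> (c *\<^sub>C \<theta>) = cnj c * dapply \<Phi> \<theta>"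
  "dapply \<Phi> 0 = 0"
  using antilinear_dapply[of \<Phi>] antilinear_scale[OF antilinear_dapply[of \<Phi>], of 0 0]
  by (simp_all add: antilinear_def scaleC_complex_def)

lemmas dapply_simps = dapply_linear_simps plus_symdual.rep_eq minus_symdual.rep_eq
  zero_symdual.rep_eq scaleC_symdual.rep_eq

lemma symdual_eqI: "(\<And>\<theta>. dapply \<Phi> \<theta> = dapply \<Psi> \<theta>) \<Longrightarrow> \<Phi> = \<Psi>"
  by (simp add: dapply_inject[symmetric] fun_eq_iff)

lemma symdual_monom_eqI:
  assumes "\<And>m. dapply \<Phi> (sym_monom m) = dapply \<Psi> (sym_monom m)"
  shows "\<Phi> = \<Psi>"
proof (rule symdual_eqI)
  fix \<theta>
  have "cnj (dapply \<Phi> \<theta>) = cnj (dapply \<Psi> \<theta>)"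
    by (rule symalg_ext[OF clinear_cnj clinear_cnj]) (simp_all add: antilinear_dapply assms)
  then show "dapply \<Phi> \<theta> = dapply \<Psi> \<theta>" by simp
qed

lemma clinear_dual_creator: "clinear (dual_creator v)"
  and clinear_dual_annihilator: "clinear (dual_annihilator v)"
  by (rule clinearI; rule symdual_eqI; simp add: dapply_dual_creator dapply_dual_annihilator dapply_simps)+

lemma clinear_dual_creator_vector: "clinear (\<lambda>v. dual_creator v \<Phi>)"
  by (rule clinearI; rule symdual_eqI)
     (simp_all add: dapply_dual_creator dapply_simps annihilator_add annihilator_scale)

lemma antilinear_dual_annihilator_vector: "antilinear (\<lambda>v. dual_annihilator v \<Phi>)"
  unfolding antilinear_def
  by (auto intro!: symdual_eqI simp: dapply_dual_annihilator dapply_simps clinear_add[OF clinear_emb]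
      clinear_scale[OF clinear_emb] distrib_right scaleC_mult_left)

lemmas dual_op_simps =
  clinear_add[OF clinear_dual_creator] clinear_scale[OF clinear_dual_creator]
  clinear_0[OF clinear_dual_creator]
  clinear_add[OF clinear_dual_annihilator] clinear_scale[OF clinear_dual_annihilator]
  clinear_0[OF clinear_dual_annihilator]
  clinear_add[OF clinear_dual_creator_vector] clinear_scale[OF clinear_dual_creator_vector]
  clinear_0[OF clinear_dual_creator_vector]
  antilinear_add[OF antilinear_dual_annihilator_vector]
  antilinear_scale[OF antilinear_dual_annihilator_vector]

lemma dual_creator_commute: "dual_creator v (dual_creator w \<Phi>) = dual_creator w (dual_creator v \<Phi>)"
  by (rule symdual_eqI) (simp add: dapply_dual_creator annihilator_commute)

lemma dual_annihilator_commute: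
  "dual_annihilator v (dual_annihilator w \<Phi>) = dual_annihilator w (dual_annihilator v \<Phi>)"
  by (rule symdual_eqI) (simp add: dapply_dual_annihilator ac_simps)

text \<open>The canonical commutation relation on \<open>SV'\<close>. The two operators exchange roles under
  transposition, and so do the arguments of the inner product, while antilinearity conjugates it back.\<close>

lemma dual_ccr:
  "dual_annihilator v (dual_creator w \<Phi>) = cinner v w *\<^sub>C \<Phi> + dual_creator w (dual_annihilator v \<Phi>)"
  by (rule symdual_eqI)
    (simp add: dapply_dual_annihilator dapply_dual_creator annihilator_emb_mult dapply_simps
      flip: cinner_commute)

section \<open>The product of the antidual\<close>

lemma coproduct_1: "coproduct 1 = 1 \<otimes>\<^sub>t 1"
  by (simp add: coproduct_def sym_lift_one[OF clinear_coproduct_generators] one_tensor_def)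

lemma coproduct_emb_mult:
  "coproduct (emb v * \<theta>) = (emb v \<otimes>\<^sub>t 1 + 1 \<otimes>\<^sub>t emb v) * coproduct \<theta>"
  by (simp add: coproduct_def sym_lift_mult[OF clinear_coproduct_generators]
      sym_lift_emb[OF clinear_coproduct_generators])

lemma antilinear_tensor_ext:
  assumes "antilinear f" "antilinear g" "\<And>x y. f (x \<otimes>\<^sub>t y) = (g (x \<otimes>\<^sub>t y) :: complex)"
  shows "f t = g t"
proof -
  have "cnj (f t) = cnj (g t)"
    by (rule tensor_ext[OF clinear_cnj clinear_cnj]) (simp_all add: assms)
  then show ?thesis by simp
qed

lemma antilinear_add_fun: "antilinear f \<Longrightarrow> antilinear g \<Longrightarrow> antilinear (\<lambda>x. f x + g x)"
  by (simp add: antilinear_def scaleC_add_right)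

lemma antilinear_mult_fun: "antilinear f \<Longrightarrow> antilinear (\<lambda>x. c * f x)" for f :: "_ \<Rightarrow> complex"
  by (simp add: antilinear_def scaleC_complex_def algebra_simps)

lemmas antilinear_tensor_dapply = antilinear_tensor_fun[OF antilinear_dapply antilinear_dapply]
lemmas tensor_dapply_pure = tensor_fun_pure[OF antilinear_dapply antilinear_dapply]

lemma symdual_add_mult: "(\<Phi> + \<Phi>') * \<Psi> = \<Phi> * \<Psi> + \<Phi>' * \<Psi>"
  for \<Phi> :: "'v::complex_vector symdual"
proof (rule symdual_eqI)
  fix \<theta>
  show "dapply ((\<Phi> + \<Phi>') * \<Psi>) \<theta> = dapply (\<Phi> * \<Psi> + \<Phi>' * \<Psi>) \<theta>"
    unfolding times_symdual.rep_eq plus_symdual.rep_eq[of "_ * _"]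
    by (rule antilinear_tensor_ext)
      (simp_all add: antilinear_tensor_fun antilinear_dapply antilinear_add_fun tensor_fun_pure plus_symdual.rep_eq
        distrib_right)
qed

lemma symdual_mult_add: "\<Phi> * (\<Psi> + \<Psi>') = \<Phi> * \<Psi> + \<Phi> * \<Psi>'"
  for \<Phi> :: "'v::complex_vector symdual"
proof (rule symdual_eqI)
  fix \<theta>
  show "dapply (\<Phi> * (\<Psi> + \<Psi>')) \<theta> = dapply (\<Phi> * \<Psi> + \<Phi> * \<Psi>') \<theta>"
    unfolding times_symdual.rep_eq plus_symdual.rep_eq[of "_ * _"]
    by (rule antilinear_tensor_ext)
      (simp_all add: antilinear_tensor_fun antilinear_dapply antilinear_add_fun tensor_fun_pure plus_symdual.rep_eq
        distrib_left)
qed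

lemma symdual_scale_mult: "(c *\<^sub>C \<Phi>) * \<Psi> = c *\<^sub>C (\<Phi> * \<Psi>)"
  for \<Phi> :: "'v::complex_vector symdual"
proof (rule symdual_eqI)
  fix \<theta>
  show "dapply ((c *\<^sub>C \<Phi>) * \<Psi>) \<theta> = dapply (c *\<^sub>C (\<Phi> * \<Psi>)) \<theta>"
    unfolding times_symdual.rep_eq scaleC_symdual.rep_eq[of _ "_ * _"]
    by (rule antilinear_tensor_ext)
      (simp_all add: antilinear_tensor_fun antilinear_dapply antilinear_mult_fun
        tensor_fun_pure scaleC_symdual.rep_eq)
qed

lemma symdual_mult_scale: "\<Phi> * (c *\<^sub>C \<Psi>) = c *\<^sub>C (\<Phi> * \<Psi>)"
  for \<Phi> :: "'v::complex_vector symdual"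
proof (rule symdual_eqI)
  fix \<theta>
  show "dapply (\<Phi> * (c *\<^sub>C \<Psi>)) \<theta> = dapply (c *\<^sub>C (\<Phi> * \<Psi>)) \<theta>"
    unfolding times_symdual.rep_eq scaleC_symdual.rep_eq[of _ "_ * _"]
    by (rule antilinear_tensor_ext)
      (simp_all add: antilinear_tensor_fun antilinear_dapply antilinear_mult_fun
        tensor_fun_pure scaleC_symdual.rep_eq)
qed

lemma symdual_0_mult: "0 * \<Phi> = 0"
  for \<Phi> :: "'v::complex_vector symdual"
  using symdual_scale_mult[of 0 0 \<Phi>] by simp

lemma symdual_mult_0: "\<Phi> * 0 = 0"
  for \<Phi> :: "'v::complex_vector symdual"
  using symdual_mult_scale[of \<Phi> 0 0] by simp

lemma dapply_mult_1: "dapply (\<Phi> * \<Psi>) 1 = dapply \<Phi> 1 * dapply \<Psi> 1"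
  by (simp add: times_symdual.rep_eq coproduct_1 tensor_dapply_pure)

lemma dapply_one_1: "dapply 1 1 = 1"
  by (simp add: one_symdual.rep_eq sym_lift_one[OF cvs_pair.linear_zero])

lemma dual_annihilator_one: "dual_annihilator v 1 = 0"
  by (rule symdual_eqI)
    (simp add: dapply_dual_annihilator one_symdual.rep_eq sym_lift_mult[OF cvs_pair.linear_zero]
      sym_lift_emb[OF cvs_pair.linear_zero] zero_symdual.rep_eq)

text \<open>Primitivity of \<open>emb v\<close> for the coproduct. Together with \<open>dapply_mult_1\<close> this computes products
  by recursion on monomials, so that identities in \<open>SV'\<close> can be proved by induction on a multiset,
  with the factors left arbitrary, without any further use of tensors.\<close>

lemma dual_annihilator_mult:
  "dual_annihilator v (\<Phi> * \<Psi>) = dual_annihilator v \<Phi> * \<Psi> + \<Phi> * dual_annihilator v \<Psi>"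
proof (rule symdual_eqI)
  fix \<theta>
  have lin: "clinear (\<lambda>t. (emb v \<otimes>\<^sub>t 1 + 1 \<otimes>\<^sub>t emb v) * t)" by (rule clinear_mult_right)
  have "tensor_fun (dapply \<Phi>) (dapply \<Psi>) ((emb v \<otimes>\<^sub>t 1 + 1 \<otimes>\<^sub>t emb v) * t) =
      tensor_fun (dapply (dual_annihilator v \<Phi>)) (dapply \<Psi>) t +
      tensor_fun (dapply \<Phi>) (dapply (dual_annihilator v \<Psi>)) t" for t
    by (rule antilinear_tensor_ext[OF antilinear_comp_clinear[OF antilinear_tensor_dapply lin]
          antilinear_add_fun[OF antilinear_tensor_dapply antilinear_tensor_dapply]])
      (simp add: distrib_right tensor_pure_mult antilinear_add[OF antilinear_tensor_dapply]
        tensor_dapply_pure dapply_dual_annihilator)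
  then show "dapply (dual_annihilator v (\<Phi> * \<Psi>)) \<theta> =
      dapply (dual_annihilator v \<Phi> * \<Psi> + \<Phi> * dual_annihilator v \<Psi>) \<theta>"
    by (simp add: dapply_dual_annihilator times_symdual.rep_eq plus_symdual.rep_eq coproduct_emb_mult)
qed

lemma symdual_one_mult: "1 * \<Phi> = \<Phi>" for \<Phi> :: "'v::complex_hilbert symdual"
proof (rule symdual_monom_eqI)
  show "dapply (1 * \<Phi>) (sym_monom m) = dapply \<Phi> (sym_monom m)" for m
    by (induction m arbitrary: \<Phi>)
      (simp_all add: dapply_mult_1 dapply_one_1 dual_annihilator_mult dual_annihilator_one symdual_0_mult
        flip: dapply_dual_annihilator)
qed

text \<open>Creators on \<open>SV'\<close> are linear over the product of \<open>SV'\<close>. A factor \<open>emb v\<close> of the argument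
  becomes an annihilator, which the commutation relation moves past \<open>dual_creator w\<close>; the scalar
  terms on the two sides agree, and the induction hypothesis covers the rest.\<close>

lemma dual_creator_mult_right: "dual_creator w (\<Phi> * \<Psi>) = \<Phi> * dual_creator w \<Psi>"
proof (rule symdual_monom_eqI)
  show "dapply (dual_creator w (\<Phi> * \<Psi>)) (sym_monom m) = dapply (\<Phi> * dual_creator w \<Psi>) (sym_monom m)" for m
  proof (induction m arbitrary: \<Phi> \<Psi>)
    case empty
    then show ?case by (simp add: dapply_mult_1 dapply_dual_creator dapply_simps)
  next
    case (add v m)
    then show ?case
      by (simp add: dual_annihilator_mult dual_ccr dual_op_simps symdual_mult_add symdual_mult_scale
          dapply_simps flip: dapply_dual_annihilator)
  qed
qed

lemma dual_creator_mult_left: "dual_creator w (\<Phi> * \<Psi>) = dual_creator w \<Phi> * \<Psi>"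
proof (rule symdual_monom_eqI)
  show "dapply (dual_creator w (\<Phi> * \<Psi>)) (sym_monom m) = dapply (dual_creator w \<Phi> * \<Psi>) (sym_monom m)" for m
  proof (induction m arbitrary: \<Phi> \<Psi>)
    case empty
    then show ?case by (simp add: dapply_mult_1 dapply_dual_creator dapply_simps)
  next
    case (add v m)
    then show ?case
      by (simp add: dual_annihilator_mult dual_ccr dual_op_simps symdual_add_mult symdual_scale_mult
          dapply_simps flip: dapply_dual_annihilator)
  qed
qed

text \<open>Thus \<open>dual_creator w\<close> is multiplication by the linear functional \<open>dual_creator w 1\<close>.\<close>

lemma dual_creator_one_mult: "dual_creator w 1 * \<Phi> = dual_creator w \<Phi>"
  by (simp add: symdual_one_mult flip: dual_creator_mult_left)

section \<open>Gaussians\<close>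

lemma sym_monom_in_grade: "sym_monom m \<in> sym_grade (size m)"
proof -
  obtain vs where m: "m = mset vs" using ex_mset by metis
  have "sym_monom m = prod_list (map emb vs)"
    by (simp add: m prod_mset_prod_list flip: mset_map)
  then show ?thesis unfolding sym_grade_def by (intro cvs.span_base) (auto simp: m)
qed

text \<open>Differentiating a quadratic form gives a linear form: both sides live in degree \<open>1\<close>.\<close>

lemma dual_annihilator_quadratic:
  assumes q: "is_quadratic Z \<zeta>"
  shows "dual_annihilator x \<zeta> = dual_creator (Z x) 1"
proof (rule symdual_monom_eqI)
  fix m
  note z = sym_lift_mult[OF cvs_pair.linear_zero] sym_lift_emb[OF cvs_pair.linear_zero]
    sym_lift_one[OF cvs_pair.linear_zero]
  have ev: "dapply (dual_creator w 1) \<theta> = cnj (sym_lift (\<lambda>_. 0) (annihilator w \<theta>))" for w \<theta> 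
    by (simp add: dapply_dual_creator one_symdual.rep_eq)
  note l = clinear_sym_lift[OF cvs_pair.linear_zero]
  have vanish: "dapply (dual_annihilator x \<zeta>) (sym_monom m) = 0" if "size m \<noteq> 1"
  proof -
    have "emb x * sym_monom m \<in> sym_grade (Suc (size m))"
      using sym_monom_in_grade[of "add_mset x m"] by simp
    moreover have "Suc (size m) \<noteq> 2" using that by simp
    ultimately show ?thesis
      using q unfolding dapply_dual_annihilator is_quadratic_def by blast
  qed
  consider "m = {#}" | y where "m = {#y#}" | y z m' where "m = add_mset y (add_mset z m')"
    by (metis multiset_cases)
  then show "dapply (dual_annihilator x \<zeta>) (sym_monom m) = dapply (dual_creator (Z x) 1) (sym_monom m)"
  proof cases
    case 1
    then show ?thesis using vanish by (simp add: dapply_dual_creator dapply_simps)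
  next
    case (2 y)
    have "annihilator (Z x) (emb y) = cinner (Z x) y *\<^sub>C 1"
      using annihilator_emb_mult[of "Z x" y 1] by simp
    then show ?thesis
      using q by (simp add: 2 ev dapply_dual_annihilator is_quadratic_def clinear_scale[OF l] z
        scaleC_complex_def flip: cinner_commute)
  next
    case (3 y z m')
    then show ?thesis using vanish
      by (simp add: ev annihilator_emb_mult clinear_add[OF l] clinear_scale[OF l] z scaleC_complex_def)
  qed
qed

lemma dual_annihilator_power:
  assumes \<zeta>: "dual_annihilator x \<zeta> = dual_creator w 1"
  shows "dual_annihilator x (\<zeta> ^ Suc n) = of_nat (Suc n) *\<^sub>C dual_creator w (\<zeta> ^ n)"
proof (induction n)
  case 0
  show ?case by (simp add: dual_annihilator_mult \<zeta> dual_annihilator_one dual_creator_one_mult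
    scaleC_one symdual_mult_0)
next
  case (Suc n)
  have "dual_annihilator x (\<zeta> ^ Suc (Suc n)) =
      dual_creator w (\<zeta> ^ Suc n) + \<zeta> * (of_nat (Suc n) *\<^sub>C dual_creator w (\<zeta> ^ n))"
    by (simp add: power_Suc[of \<zeta> "Suc n"] dual_annihilator_mult \<zeta> dual_creator_one_mult Suc.IH del: power_Suc of_nat_Suc)
  also have "\<zeta> * (of_nat (Suc n) *\<^sub>C dual_creator w (\<zeta> ^ n)) = of_nat (Suc n) *\<^sub>C dual_creator w (\<zeta> ^ Suc n)"
    by (simp add: symdual_mult_scale dual_creator_mult_right)
  finally show ?case by (simp only: of_nat_Suc[of "Suc n"] scaleC_add_left scaleC_one)
qed

text \<open>The differential equation of the Gaussian. Term \<open>n + 1\<close> of the exponential series on the left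
  is term \<open>n\<close> on the right, by the power rule.\<close>

lemma dual_annihilator_exp:
  assumes z1: "dapply \<zeta> 1 = 0" and \<zeta>: "dual_annihilator x \<zeta> = dual_creator w 1"
  shows "dual_annihilator x (dual_exp \<zeta>) = dual_creator w (dual_exp \<zeta>)"
proof (rule symdual_eqI)
  fix \<theta>
  let ?t = "\<lambda>\<theta> n. dapply (\<zeta> ^ n) \<theta> / fact n"
  have s: "summable (?t \<theta>)" for \<theta>
    by (rule summable_finite[OF finite_dapply_power[OF z1, of \<theta>]]) auto
  have "?t (emb x * \<theta>) (Suc n) = ?t (annihilator w \<theta>) n" for n
  proof -
    have "dapply (\<zeta> ^ Suc n) (emb x * \<theta>) = of_nat (Suc n) * dapply (\<zeta> ^ n) (annihilator w \<theta>)"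
      by (simp only: dapply_dual_annihilator[symmetric] dual_annihilator_power[OF \<zeta>]
          scaleC_symdual.rep_eq dapply_dual_creator)
    then show ?thesis by (simp del: power_Suc of_nat_Suc)
  qed
  moreover have "?t (emb x * \<theta>) 0 = 0"
    using arg_cong[OF dual_annihilator_one[of x], of "\<lambda>\<Phi>. dapply \<Phi> \<theta>"]
    by (simp add: dapply_dual_annihilator zero_symdual.rep_eq)
  ultimately have "suminf (?t (emb x * \<theta>)) = suminf (?t (annihilator w \<theta>))"
    using suminf_split_head[OF s[of "emb x * \<theta>"]] by (simp del: power_Suc)
  then show "dapply (dual_annihilator x (dual_exp \<zeta>)) \<theta> = dapply (dual_creator w (dual_exp \<zeta>)) \<theta>"
    by (simp add: dapply_dual_annihilator dapply_dual_creator dapply_dual_exp[OF z1])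
qed

lemma dapply_dual_exp_1:
  assumes "dapply \<zeta> 1 = 0" shows "dapply (dual_exp \<zeta>) 1 = 1"
proof -
  have "dapply (\<zeta> ^ n) 1 = 0 ^ n" for n
    by (induction n) (simp_all add: dapply_mult_1 dapply_one_1 assms)
  then have "(\<lambda>n. dapply (\<zeta> ^ n) 1 / fact n) = (\<lambda>n. if n = 0 then 1 else 0)"
    by (auto simp: fun_eq_iff)
  then show ?thesis
    using sums_unique[OF sums_single[of 0 "\<lambda>_. 1 :: complex"]] by (simp add: dapply_dual_exp[OF assms])
qed

text \<open>Any drop of the degree suffices for the induction below, hence a bound instead of the exact degree.\<close>

lemma annihilator_monom_span:
  "annihilator w (sym_monom m) \<in> cvs.span {sym_monom m' |m'. size m' < size m}"
proof (induction m)
  case empty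
  then show ?case by (simp add: cvs.span_zero)
next
  case (add v m)
  let ?S = "\<lambda>n. cvs.span {sym_monom m' |m' :: 'a multiset. size m' < n}"
  have "emb v * t \<in> ?S (Suc n)" if "t \<in> ?S n" for t n
    using that
  proof (induction rule: cvs.span_induct_alt)
    case base
    show ?case by (simp add: cvs.span_zero)
  next
    case (step c x y)
    then obtain m' where x: "x = sym_monom m'" "size m' < n" by blast
    have "emb v * x \<in> ?S (Suc n)"
      by (rule cvs.span_base) (use x in \<open>auto intro!: exI[of _ "add_mset v m'"]\<close>)
    then show ?case using step.IH
      by (simp add: distrib_left scaleC_mult_right cvs.span_add cvs.span_scale)
  qed
  moreover have "sym_monom m \<in> ?S (Suc (size m))" by (rule cvs.span_base) auto
  ultimately show ?case using add.IH
    by (simp add: annihilator_emb_mult cvs.span_add cvs.span_scale)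
qed

text \<open>The equation trades the factor \<open>x\<close> of a monomial for an annihilator applied to the remaining
  ones, and so lowers the degree by two; in the end only the value at \<open>1\<close> is left.\<close>

lemma symdual_eq_0I:
  assumes D: "\<And>x. dual_annihilator x \<Phi> = dual_creator (Z x) \<Phi>" and z: "dapply \<Phi> 1 = 0"
  shows "\<Phi> = 0"
proof (rule symdual_monom_eqI)
  fix m
  show "dapply \<Phi> (sym_monom m) = dapply 0 (sym_monom m)"
    unfolding zero_symdual.rep_eq
  proof (induction m rule: measure_induct_rule[of size])
    case (less m)
    show ?case
    proof (cases m)
      case empty
      then show ?thesis by (simp add: z)
    next
      case (add x m')
      have "dapply \<Phi> (sym_monom m) = dapply \<Phi> (annihilator (Z x) (sym_monom m'))"
        using arg_cong[OF D[of x], of "\<lambda>\<Psi>. dapply \<Psi> (sym_monom m')"]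
        by (simp add: add dapply_dual_annihilator dapply_dual_creator)
      also have "\<dots> = 0"
        by (rule antilinear_eq_0_on_span[OF antilinear_dapply annihilator_monom_span])
          (use less.IH in \<open>auto simp: add\<close>)
      finally show ?thesis .
    qed
  qed
qed

section \<open>Transformed creators and annihilators\<close>

definition transformed_annihilator ::
  "('v::complex_hilbert \<Rightarrow> 'v) \<Rightarrow> 'v \<Rightarrow> 'v symdual \<Rightarrow> 'v symdual" where
  "transformed_annihilator g v \<Phi> = dual_annihilator (C_part g v) \<Phi> + dual_creator (A_part g v) \<Phi>"

lemma clinear_transformed_creator: "clinear (transformed_creator g v)"
  and clinear_transformed_annihilator: "clinear (transformed_annihilator g v)"
  unfolding transformed_creator_def transformed_annihilator_def
  by (intro clinear_add_fun clinear_dual_creator clinear_dual_annihilator)+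

lemma clinear_transformed_creator_vector:
  assumes "g \<in> Sp" shows "clinear (\<lambda>v. transformed_creator g v \<Phi>)"
proof -
  have lin: "linear g" using assms by (simp add: Sp_def)
  show ?thesis
    by (rule clinearI)
      (simp_all add: transformed_creator_def dual_op_simps clinear_add[OF clinear_C_part[OF lin]]
        clinear_scale[OF clinear_C_part[OF lin]] antilinear_add[OF antilinear_A_part[OF lin]]
        antilinear_scale[OF antilinear_A_part[OF lin]] scaleC_add_right)
qed

text \<open>The two scalars that arise from the commutation relation cancel because \<open>\<langle>C v, A w\<rangle>\<close> is symmetric
  in \<open>v\<close> and \<open>w\<close>.\<close>

lemma transformed_creator_commute:
  assumes "g \<in> Sp"
  shows "transformed_creator g v (transformed_creator g w \<Phi>) =
    transformed_creator g w (transformed_creator g v \<Phi>)"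
proof -
  have "cinner (A_part g v) (C_part g w) = cinner (A_part g w) (C_part g v)"
    using symplectic_relations(2)[OF assms, of v w]
    by (metis cinner_commute)
  then show ?thesis
    by (simp add: transformed_creator_def dual_op_simps dual_ccr dual_creator_commute[of "C_part g v"]
        dual_annihilator_commute[of "A_part g v"] algebra_simps)
qed

text \<open>The transformation preserves the commutation relation because the scalar
  \<open>\<langle>C v, C w\<rangle> - \<langle>A w, A v\<rangle>\<close> is \<open>\<langle>v, w\<rangle>\<close>.\<close>

lemma transformed_ccr:
  assumes "g \<in> Sp"
  shows "transformed_annihilator g v (transformed_creator g w \<Phi>) =
    cinner v w *\<^sub>C \<Phi> + transformed_creator g w (transformed_annihilator g v \<Phi>)"
  unfolding symplectic_relations(1)[OF assms, of v w, symmetric] cvs.scale_left_diff_distrib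
  by (simp add: transformed_creator_def transformed_annihilator_def dual_op_simps dual_ccr
      dual_creator_commute[of "A_part g v"] dual_annihilator_commute[of "C_part g v"] algebra_simps)

lemma dual_field_op_transformed:
  "dual_field_op (g v) \<Phi> =
    complex_of_real (1 / sqrt 2) *\<^sub>C (transformed_creator g v \<Phi> + transformed_annihilator g v \<Phi>)"
  unfolding C_plus_A[of g v, symmetric]
  by (simp add: dual_field_op_def transformed_creator_def transformed_annihilator_def dual_op_simps
      algebra_simps)

text \<open>Substitute \<open>x = C\<^sub>g v\<close>, which runs through all of \<open>V\<close>, so that \<open>A\<^sub>g v = - Z\<^sub>g x\<close>.\<close>

lemma annihilated_iff_gaussian:
  assumes g: "g \<in> Sp"
  shows "(\<forall>v. transformed_annihilator g v \<Phi> = 0) \<longleftrightarrow>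
    (\<forall>x. dual_annihilator x \<Phi> = dual_creator (Z_op g x) \<Phi>)"
proof -
  have "transformed_annihilator g v \<Phi> = 0 \<longleftrightarrow>
      dual_annihilator (C_part g v) \<Phi> = dual_creator (Z_op g (C_part g v)) \<Phi>" for v
    by (simp add: Z_op_C_part[OF g] transformed_annihilator_def eq_neg_iff_add_eq_0
        cvs_pair.linear_neg[OF clinear_dual_creator_vector])
  then show ?thesis
    using bij_is_surj[OF bij_C_part[OF g]] by (metis surjD)
qed

lemma
  assumes g: "g \<in> Sp"
  shows dapply_gauss_1: "dapply (gauss g) 1 = 1"
    and transformed_annihilator_gauss: "transformed_annihilator g v (gauss g) = 0"
proof -
  have q: "is_quadratic (Z_op g) (quadratic (Z_op g))"
    unfolding quadratic_def
    by (rule theI'[OF ex1_quadratic[OF antilinear_Z_op[OF g] Z_op_symmetric[OF g]]])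
  moreover have "(1 :: 'a symalg) \<in> sym_grade 0" using sym_monom_in_grade[of "{#}"] by simp
  ultimately have z: "dapply (quadratic (Z_op g)) 1 = 0"
    unfolding is_quadratic_def by (metis zero_neq_numeral)
  show "dapply (gauss g) 1 = 1" unfolding gauss_def by (rule dapply_dual_exp_1[OF z])
  show "transformed_annihilator g v (gauss g) = 0"
    using annihilated_iff_gaussian[OF g, of "gauss g"]
      dual_annihilator_exp[OF z dual_annihilator_quadratic[OF q]]
    by (simp add: gauss_def)
qed

text \<open>Uniqueness of the transformed vacuum up to a scalar, which its value at \<open>1\<close> detects.\<close>

lemma annihilated_eq_scale_gauss:
  assumes g: "g \<in> Sp" and ann: "\<And>v. transformed_annihilator g v \<Phi> = 0"
  shows "\<Phi> = dapply \<Phi> 1 *\<^sub>C gauss g"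
proof -
  let ?D = "\<Phi> - dapply \<Phi> 1 *\<^sub>C gauss g"
  have "transformed_annihilator g v ?D = 0" for v
    by (simp add: clinear_diff[OF clinear_transformed_annihilator]
      clinear_scale[OF clinear_transformed_annihilator] ann transformed_annihilator_gauss[OF g])
  moreover have "dapply ?D 1 = 0" by (simp add: dapply_simps dapply_gauss_1[OF g])
  ultimately have "?D = 0"
    using annihilated_iff_gaussian[OF g] by (intro symdual_eq_0I) blast+
  then show ?thesis by simp
qed

section \<open>Implementers\<close>

text \<open>The operators \<open>\<pi>\<close> are only real-linear in the vector, but creator and annihilator can be
  recovered from \<open>\<pi>(v)\<close> and \<open>\<pi>(\<i> v)\<close>, on both sides: replacing \<open>v\<close> by \<open>\<i> v\<close> multiplies
  the creators by \<open>\<i>\<close> and the annihilators by \<open>- \<i>\<close>.\<close>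

lemma implements_iff_intertwines:
  assumes g: "linear g" and U: "clinear U"
  shows "(\<forall>v \<psi>. U (field_op v \<psi>) = dual_field_op (g v) (U \<psi>)) \<longleftrightarrow>
    (\<forall>v \<psi>. U (creator v \<psi>) = transformed_creator g v (U \<psi>)) \<and>
    (\<forall>v \<psi>. U (annihilator v \<psi>) = transformed_annihilator g v (U \<psi>))" (is "?L \<longleftrightarrow> ?R")
proof
  note [simp] = clinear_add[OF U] clinear_scale[OF U] cvs_pair.linear_neg[OF U]
  show ?L if ?R using that by (simp add: field_op_def dual_field_op_transformed)
  assume L: ?L
  have sum: "U (creator v \<psi>) + U (annihilator v \<psi>) =
      transformed_creator g v (U \<psi>) + transformed_annihilator g v (U \<psi>)" for v \<psi>
    using L[rule_format, of v \<psi>] by (simp add: field_op_def dual_field_op_transformed)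
  note lin = clinear_scale[OF clinear_C_part[OF g]] antilinear_scale[OF antilinear_A_part[OF g]]
  have diff: "U (creator v \<psi>) - U (annihilator v \<psi>) =
      transformed_creator g v (U \<psi>) - transformed_annihilator g v (U \<psi>)" for v \<psi>
  proof -
    have "\<i> *\<^sub>C (U (creator v \<psi>) - U (annihilator v \<psi>)) =
        U (creator (\<i> *\<^sub>C v) \<psi>) + U (annihilator (\<i> *\<^sub>C v) \<psi>)"
      by (simp add: creator_def clinear_scale[OF clinear_emb] scaleC_mult_left annihilator_scale
          cvs.scale_right_diff_distrib cvs.scale_minus_left)
    also have "\<dots> = transformed_creator g (\<i> *\<^sub>C v) (U \<psi>) + transformed_annihilator g (\<i> *\<^sub>C v) (U \<psi>)"
      by (rule sum)
    also have "\<dots> = \<i> *\<^sub>C (transformed_creator g v (U \<psi>) - transformed_annihilator g v (U \<psi>))"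
      unfolding transformed_creator_def transformed_annihilator_def lin dual_op_simps
      by (simp add: cvs.scale_right_diff_distrib scaleC_add_right cvs.scale_minus_left)
    finally show ?thesis by simp
  qed
  have half: "x = x' \<and> y = y'" if "x + y = x' + y'" "x - y = x' - y'" for x y x' y' :: "'a symdual"
  proof -
    have "2 *\<^sub>C x = (x + y) + (x - y)" using scaleC_add_left[of 1 1 x] by (simp add: scaleC_one)
    also have "\<dots> = 2 *\<^sub>C x'" using scaleC_add_left[of 1 1 x'] by (simp add: that scaleC_one)
    finally show ?thesis using that by simp
  qed
  show ?R using half[OF sum diff] by blast
qed

theorem theorem3p10:
  fixes g :: "'v::complex_hilbert \<Rightarrow> 'v"
  assumes "g \<in> Sp"
  shows "\<exists>U :: 'v symalg \<Rightarrow> 'v symdual.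
    (\<forall>W. clinear W \<and> W 1 = gauss g \<and>
          (\<forall>vs. W (prod_list (map emb vs)) = foldr (transformed_creator g) vs (gauss g))
        \<longleftrightarrow> W = U) \<and>
    {W. fock_implementer g W} = {(\<lambda>\<psi>. k *\<^sub>C U \<psi>) |k. k \<noteq> 0}"
proof -
  note g = assms
  have lin: "linear g" using g by (simp add: Sp_def)
  obtain U where U: "clinear U" and U1: "U 1 = gauss g"
    and Uc: "\<And>v \<psi>. U (emb v * \<psi>) = transformed_creator g v (U \<psi>)"
    using ex_clinear_of_commuting_family[OF clinear_transformed_creator
        clinear_transformed_creator_vector[OF g] transformed_creator_commute[OF g]] by metis
  have U_prod: "U (prod_list (map emb vs)) = foldr (transformed_creator g) vs (gauss g)" for vs
    by (induction vs) (simp_all add: U1 Uc)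
  have unique: "W = U" if "clinear W"
    and "\<And>vs. W (prod_list (map emb vs)) = foldr (transformed_creator g) vs (gauss g)" for W
  proof (rule ext, rule symalg_ext[OF that(1) U])
    fix m :: "'v multiset"
    obtain vs where "m = mset vs" using ex_mset by metis
    then have "sym_monom m = prod_list (map emb vs)" by (simp add: prod_mset_prod_list flip: mset_map)
    then show "W (sym_monom m) = U (sym_monom m)" by (simp add: that(2) U_prod)
  qed
  \<comment> \<open>vacuum condition at \<open>1\<close>, then the commutation relations carry it through every factor\<close>
  have Ua: "U (annihilator v \<psi>) = transformed_annihilator g v (U \<psi>)" for v \<psi>
  proof (rule symalg_ext[of "\<lambda>\<psi>. U (annihilator v \<psi>)"])
    show "U (annihilator v (sym_monom m)) = transformed_annihilator g v (U (sym_monom m))" for m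
      by (induction m)
        (simp_all add: U1 Uc clinear_0[OF U] clinear_add[OF U] clinear_scale[OF U]
          transformed_annihilator_gauss[OF g] annihilator_emb_mult transformed_ccr[OF g])
  qed (intro Vector_Spaces.linear_compose[unfolded o_def, OF clinear_annihilator U]
      Vector_Spaces.linear_compose[unfolded o_def, OF U clinear_transformed_annihilator])+
  have "fock_implementer g (\<lambda>\<psi>. k *\<^sub>C U \<psi>)" if "k \<noteq> 0" for k
  proof -
    have kU: "clinear (\<lambda>\<psi>. k *\<^sub>C U \<psi>)" by (rule clinear_scale_fun[OF U])
    have "dapply (k *\<^sub>C U 1) 1 \<noteq> 0"
      using that by (simp add: U1 dapply_simps dapply_gauss_1[OF g])
    then have "(\<lambda>\<psi>. k *\<^sub>C U \<psi>) \<noteq> (\<lambda>_. 0)" by (metis zero_symdual.rep_eq)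
    moreover have "\<forall>v \<psi>. k *\<^sub>C U (field_op v \<psi>) = dual_field_op (g v) (k *\<^sub>C U \<psi>)"
      unfolding implements_iff_intertwines[OF lin kU]
      by (simp add: creator_def Uc Ua clinear_scale[OF clinear_transformed_creator]
          clinear_scale[OF clinear_transformed_annihilator])
    ultimately show ?thesis using kU by (simp add: fock_implementer_def)
  qed
  moreover have "\<exists>k. W = (\<lambda>\<psi>. k *\<^sub>C U \<psi>) \<and> k \<noteq> 0" if "fock_implementer g W" for W
  proof -
    have W: "clinear W" and nz: "W \<noteq> (\<lambda>_. 0)"
      and "\<forall>v \<psi>. W (field_op v \<psi>) = dual_field_op (g v) (W \<psi>)"
      using that by (simp_all add: fock_implementer_def)
    then have Wc: "W (emb v * \<psi>) = transformed_creator g v (W \<psi>)"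
      and Wa: "W (annihilator v \<psi>) = transformed_annihilator g v (W \<psi>)" for v \<psi>
      unfolding implements_iff_intertwines[OF lin W] by (simp_all add: creator_def)
    define k where "k = dapply (W 1) 1"
    have "transformed_annihilator g v (W 1) = 0" for v
      using Wa[of v 1] by (simp add: clinear_0[OF W])
    then have "W 1 = k *\<^sub>C U 1"
      unfolding k_def U1 by (rule annihilated_eq_scale_gauss[OF g])
    then have "W = (\<lambda>\<psi>. k *\<^sub>C U \<psi>)"
      by (intro symalg_eq_of_emb_mult[of _ _ "transformed_creator g"] W clinear_scale_fun[OF U])
        (simp_all add: Wc Uc clinear_scale[OF clinear_transformed_creator])
    moreover from this have "k \<noteq> 0" using nz by auto
    ultimately show ?thesis by blast
  qed
  ultimately have "{W. fock_implementer g W} = {(\<lambda>\<psi>. k *\<^sub>C U \<psi>) |k. k \<noteq> 0}" by blast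
  then show ?thesis
    using U U1 U_prod unique by (intro exI[of _ U]) blast
qed

end
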